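(* Let $n,m\in\{1,2,\dots\}$, $A\in\mathbb R^{n\times n}$, $B\in\mathbb R^{n\times m}\setminus\{0\}$ and $x_0\in\mathbb R^n\setminus\{0\}$. Assume that the time optimal control problem $(\mathcal{TP})_{x_0}$ has an admissible control. Let $T^*_{x_0}$ be its optimal time, $u^*_{x_0}$ its optimal control, and $\mathbb S_{x_0}$ the set of switching points of $u^*_{x_0}$ over $(0,T^*_{x_0})$. Then: (i) If $I\subset(0,T^*_{x_0})$ is an open interval whose length satisfies $|I|\le d_A$, then $\sharp[\mathbb S_{x_0}\cap I]\le q_{A,B}-1$. (ii) For every $\hat t\in\mathbb S_{x_0}$, $$\lim_{t\to\hat t^-}u^*_{x_0}(t)+\lim_{t\to\hat t^+}u^*_{x_0}(t)=0 .$$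
   Context: Notation: $\mathbb R^+=(0,+\infty)$; $B_1(0)$ is the closed unit ball of $\mathbb R^m$ (Euclidean norm) centered at $0$; $\sharp E$ is the cardinality of $E$. $\mathcal{PC}(\mathbb R^+;E)$ (with $\emptyset\ne E\subset\mathbb R^m$) is the set of all piecewise continuous and left continuous functions $\mathbb R^+\to E$ with finitely many discontinuities. Control system: for $u\in\mathcal{PC}(\mathbb R^+;\mathbb R^m)$, $x(\cdot;x_0,u)$ is the solution of $x'(t)=Ax(t)+Bu(t)$, $t\ge0$, $x(0)=x_0$. Problem $(\mathcal{TP})_{x_0}$: $T^*_{x_0}=\inf\{\hat t>0:\exists u\in\mathcal{PC}(\mathbb R^+;B_1(0))\text{ s.t. }x(\hat t;x_0,u)=0\}$ is the optimal time. A control $u\in\mathcal{PC}(\mathbb R^+;B_1(0))$ is admissible if $x(\hat t;x_0,u)=0$ for some $\hat t>0$. A control $u^*_{x_0}\in\mathcal{PC}(\mathbb R^+;B_1(0))$ is an optimal control if $x(T^*_{x_0};x_0,u^*_{x_0})=0$ and $u^*_{x_0}(t)=0$ for all $t>T^*_{x_0}$. When an admissible control exists, $0<T^*_{x_0}<+\infty$ and there is exactly one optimal control, denoted $u^*_{x_0}$. A switching point of $u^*_{x_0}$ is a discontinuity $\hat t$ of $u^*_{x_0}$, i.e. $u^*_{x_0}(\hat t)=\lim_{t\to\hat t^-}u^*_{x_0}(t)\ne\lim_{t\to\hat t^+}u^*_{x_0}(t)$; $\mathbb S_{x_0}$ is the set of all switching points lying in $(0,T^*_{x_0})$. Constants: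 $d_A=\min\{\pi/|\mathrm{Im}\,\lambda|:\lambda\in\sigma(A)\}$, where $\sigma(A)$ is the (complex) spectrum of $A$ and $1/0=+\infty$; $q_{A,B}=\max\{\dim\mathcal V_A(b): b\text{ is a column of }B\}$, where $\mathcal V_A(b)=\mathrm{span}\{b,Ab,\dots,A^{n-1}b\}$. *)

theory Defs
  imports "HOL-Analysis.Analysis"
begin

(* Functions on (0, +infinity) are represented by total functions on the reals of which only the
   values at positive arguments matter.  Piecewise continuity includes the existence of the finite
   one-sided limits; the limit from the left at t is u t, by left continuity.  Nothing is required
   at the left end point 0 of the domain. *)
definition PC :: "'a::topological_space set \<Rightarrow> (real \<Rightarrow> 'a) set" where
  "PC E = {u. (\<forall>t>0. u t \<in> E)
            \<and> finite {t. 0 < t \<and> \<not> isCont u t}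
            \<and> (\<forall>t>0. (u \<longlongrightarrow> u t) (at_left t))
            \<and> (\<forall>t>0. \<exists>r. (u \<longlongrightarrow> r) (at_right t))}"

(* x is the solution of x' = A x + B u, x(0) = x0, on [0, +infinity), in the usual sense for a
   piecewise continuous u: x is continuous and satisfies the equation wherever u is continuous.
   For u with finitely many discontinuities this determines x on [0, +infinity). *)
definition is_solution ::
  "real^'n^'n \<Rightarrow> real^'m^'n \<Rightarrow> real^'n \<Rightarrow> (real \<Rightarrow> real^'m) \<Rightarrow> (real \<Rightarrow> real^'n) \<Rightarrow> bool" where
  "is_solution A B x0 u x \<longleftrightarrow>
     continuous_on {0..} x \<and> x 0 = x0 \<and>
     (\<forall>t>0. isCont u t \<longrightarrow> (x has_vector_derivative (A *v x t + B *v u t)) (at t))"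

definition steers_to_zero ::
  "real^'n^'n \<Rightarrow> real^'m^'n \<Rightarrow> real^'n \<Rightarrow> (real \<Rightarrow> real^'m) \<Rightarrow> real \<Rightarrow> bool" where
  "steers_to_zero A B x0 u t \<longleftrightarrow> (\<exists>x. is_solution A B x0 u x \<and> x t = 0)"

definition optimal_time :: "real^'n^'n \<Rightarrow> real^'m^'n \<Rightarrow> real^'n \<Rightarrow> real" where
  "optimal_time A B x0 = Inf {t. 0 < t \<and> (\<exists>u \<in> PC (cball 0 1). steers_to_zero A B x0 u t)}"

definition admissible_control ::
  "real^'n^'n \<Rightarrow> real^'m^'n \<Rightarrow> real^'n \<Rightarrow> (real \<Rightarrow> real^'m) \<Rightarrow> bool" where
  "admissible_control A B x0 u \<longleftrightarrow>
     u \<in> PC (cball 0 1) \<and> (\<exists>t>0. steers_to_zero A B x0 u t)"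

definition optimal_control ::
  "real^'n^'n \<Rightarrow> real^'m^'n \<Rightarrow> real^'n \<Rightarrow> (real \<Rightarrow> real^'m) \<Rightarrow> bool" where
  "optimal_control A B x0 u \<longleftrightarrow>
     u \<in> PC (cball 0 1) \<and>
     steers_to_zero A B x0 u (optimal_time A B x0) \<and>
     (\<forall>t > optimal_time A B x0. u t = 0)"

definition switching_points :: "real \<Rightarrow> (real \<Rightarrow> 'a::topological_space) \<Rightarrow> real set" where
  "switching_points T u = {t. 0 < t \<and> t < T \<and> \<not> isCont u t}"

definition complex_spectrum :: "real^'n^'n \<Rightarrow> complex set" where
  "complex_spectrum A =
     {l. \<exists>v. v \<noteq> 0 \<and> map_matrix complex_of_real A *v v = l *s v}"

(* Division in ereal: pi / 0 = \<infinity>, so real eigenvalues contribute \<infinity>. *)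
definition d_const :: "real^'n^'n \<Rightarrow> ereal" where
  "d_const A = Min ((\<lambda>l. ereal pi / ereal \<bar>Im l\<bar>) ` complex_spectrum A)"

(* Powers of A are taken as iterates of the linear map: the operations * and ^ on vec types are
   componentwise. *)
definition krylov :: "real^'n^'n \<Rightarrow> real^'n \<Rightarrow> (real^'n) set" where
  "krylov A b = span ((\<lambda>k. (((*v) A) ^^ k) b) ` {..<CARD('n)})"

definition q_const :: "real^'n^'n \<Rightarrow> real^'m^'n \<Rightarrow> nat" where
  "q_const A B = Max (range (\<lambda>j. dim (krylov A (column j B))))"

end

theory Submission
  imports Defs "HOL-Computational_Algebra.Fundamental_Theorem_Algebra"
begin

text \<open>
  Let \<open>T\<close> be the optimal time. Writing the system by variation of constants turns steering \<open>x0\<close> to the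
  origin at time \<open>t\<close> into the equation \<open>\<integral> exp (- s A) B u(s) ds = - x0\<close> over \<open>[0, t]\<close>. The values of this
  integral for controls that end before \<open>T\<close> form a convex set that misses \<open>- x0\<close>. A separating hyperplane
  (\<open>time_optimal_separation\<close>) and a needle variation (\<open>maximum_principle\<close>) show that
  \<open>u = p / |p|\<close> wherever the switching function \<open>p(s) = B\<^sup>T exp (- s A\<^sup>T) \<eta>\<close> is nonzero. Even if
  the pair \<open>(A, B)\<close> is not controllable, the normal \<open>\<eta>\<close> can be chosen so that it does not annihilate
  all vectors \<open>A ^ k b\<close> with \<open>b\<close> a column of \<open>B\<close>, and then \<open>p\<close> has only zeros of finite order.

  Near a zero of order \<open>k\<close> the direction of \<open>p\<close> is \<open>(t - s) ^ k\<close> times a vector with a nonzero limit. So the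
  control is continuous if \<open>k\<close> is even and reverses its sign if \<open>k\<close> is odd. This is the second assertion,
  and it shows that every switching point is a zero of \<open>p\<close> (\<open>switching_structure\<close>).

  For the first assertion it remains to count the zeros of one nontrivial component
  \<open>\<eta> \<bullet> exp (- s A) b\<close> of \<open>p\<close>. It satisfies a linear differential equation with constant coefficients
  whose characteristic polynomial is, up to the substitution of \<open>- x\<close> for \<open>x\<close>, the minimal polynomial of
  \<open>A\<close> relative to \<open>b\<close>. The order of the equation is thus the dimension of the Krylov space of \<open>b\<close>, and the
  characteristic roots are negatives of eigenvalues of \<open>A\<close> (\<open>krylov_annihilator\<close>). A nontrivial solution
  of an equation of order \<open>k\<close> has at most \<open>k - 1\<close> zeros on an open interval of length at most \<open>\<pi> / |\<omega>|\<close> for all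
  imaginary parts \<open>\<omega>\<close> of the roots (\<open>zero_bound\<close>): on such an interval the differential operator splits
  into first order factors with positive weights, and each of them costs one application of Rolle's
  theorem.
\<close>

section \<open>Polynomials acting on a vector space\<close>

definition poly_act :: "('v::real_vector \<Rightarrow> 'v) \<Rightarrow> real poly \<Rightarrow> 'v \<Rightarrow> 'v" where
  "poly_act L p v = (\<Sum>i\<le>degree p. coeff p i *\<^sub>R (L ^^ i) v)"

lemma poly_act_upto:
  assumes "degree p \<le> n"
  shows "poly_act L p v = (\<Sum>i\<le>n. coeff p i *\<^sub>R (L ^^ i) v)"
  unfolding poly_act_def
  by (rule sum.mono_neutral_left) (use assms in \<open>auto simp: coeff_eq_0\<close>)

lemma poly_act_0 [simp]: "poly_act L 0 v = 0"
  by (simp add: poly_act_def)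

lemma poly_act_add: "poly_act L (p + q) v = poly_act L p v + poly_act L q v"
proof -
  let ?n = "max (degree p) (degree q)"
  show ?thesis
    by (simp add: poly_act_upto[of _ ?n] degree_add_le_max scaleR_add_left sum.distrib)
qed

lemma poly_act_smult: "poly_act L (smult c p) v = c *\<^sub>R poly_act L p v"
  by (simp add: poly_act_upto[OF degree_smult_le] poly_act_def scaleR_sum_right)

lemma funpow_linear:
  fixes L :: "'v::real_vector \<Rightarrow> 'v"
  assumes "linear L"
  shows "linear (L ^^ i)"
proof (induction i)
  case 0
  then show ?case by (simp add: linear_iff)
next
  case (Suc i)
  then show ?case
    using linear_compose[OF Suc assms] by (simp add: comp_def)
qed

lemma linear_poly_act:
  assumes "linear L"
  shows "linear (poly_act L p)"
  unfolding poly_act_def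
  by (intro linear_compose_sum ballI linear_compose_scale_right funpow_linear assms)

lemma poly_act_pCons:
  assumes "linear L"
  shows "poly_act L (pCons a p) v = a *\<^sub>R v + L (poly_act L p v)"
proof -
  have "poly_act L (pCons a p) v = (\<Sum>i\<le>Suc (degree p). coeff (pCons a p) i *\<^sub>R (L ^^ i) v)"
    by (rule poly_act_upto) (simp add: degree_pCons_le)
  also have "\<dots> = a *\<^sub>R v + (\<Sum>i\<le>degree p. coeff p i *\<^sub>R L ((L ^^ i) v))"
    by (subst sum.atMost_Suc_shift) simp
  finally show ?thesis
    by (simp add: poly_act_def linear_sum[OF assms] linear_cmul[OF assms])
qed

lemma poly_act_mult:
  assumes "linear L"
  shows "poly_act L (p * q) v = poly_act L p (poly_act L q v)"
proof (induction p)
  case 0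
  then show ?case by simp
next
  case (pCons a p)
  then show ?case
    by (simp add: poly_act_add poly_act_smult poly_act_pCons[OF assms])
qed

abbreviation quad_poly :: "real \<Rightarrow> real \<Rightarrow> real poly" where
  "quad_poly c \<omega> \<equiv> [:c\<^sup>2 + \<omega>\<^sup>2, - 2 * c, 1:]"

lemma poly_act_linear_factor:
  assumes "linear L"
  shows "poly_act L [:- c, 1:] v = L v - c *\<^sub>R v"
  by (simp add: poly_act_pCons[OF assms] linear_0[OF assms])

lemma poly_act_quad_poly:
  assumes "linear L"
  shows "poly_act L (quad_poly c \<omega>) v =
    poly_act L [:- c, 1:] (poly_act L [:- c, 1:] v) + \<omega>\<^sup>2 *\<^sub>R v"
proof -
  have "quad_poly c \<omega> = [:- c, 1:] * [:- c, 1:] + [:\<omega>\<^sup>2:]"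
    by (simp add: power2_eq_square)
  then have "poly_act L (quad_poly c \<omega>) v
      = poly_act L ([:- c, 1:] * [:- c, 1:]) v + poly_act L [:\<omega>\<^sup>2:] v"
    by (simp only: poly_act_add)
  also have "poly_act L [:\<omega>\<^sup>2:] v = \<omega>\<^sup>2 *\<^sub>R v"
    by (simp add: poly_act_pCons[OF assms] linear_0[OF assms])
  finally show ?thesis
    by (simp only: poly_act_mult[OF assms])
qed

text \<open>
  The quadratic case comes from a non-real complex root: the remainder of \<open>p\<close> modulo the quadratic
  polynomial of that root is a real polynomial of degree at most one which vanishes at a non-real
  number, hence it is zero. Evaluation at the root \<open>z\<close> is the action of multiplication by \<open>z\<close>,
  applied to \<open>1\<close> in the real vector space of complex numbers, so the multiplicativity of \<^const>\<open>poly_act\<close> applies to it.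
\<close>

lemma real_poly_factor_cases:
  fixes p :: "real poly"
  assumes "degree p > 0"
  obtains l where "[:- l, 1:] dvd p"
  | c \<omega> where "0 < \<omega>" "quad_poly c \<omega> dvd p"
proof -
  let ?P = "map_poly complex_of_real p"
  have degP: "degree ?P = degree p"
    by (simp add: degree_map_poly)
  then have "\<not> constant (poly ?P)"
    using assms by (simp add: constant_degree)
  then obtain z where z: "poly ?P z = 0"
    using fundamental_theorem_of_algebra by blast
  have lz: "linear (\<lambda>v. z * v)"
    by (rule bounded_linear.linear[OF bounded_linear_mult_right])
  define ev where "ev p = poly_act (\<lambda>v. z * v) p 1" for p
  have pw: "((\<lambda>v. z * v) ^^ i) 1 = z ^ i" for i
    by (induction i) auto
  have ev: "ev p = 0"
    using z by (simp add: ev_def poly_act_def pw poly_altdef degP coeff_map_poly scaleR_conv_of_real)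
  show thesis
  proof (cases "Im z = 0")
    case True
    then have "z = of_real (Re z)"
      by (simp add: complex_eq_iff)
    then have "poly ?P (of_real (Re z)) = 0"
      using z by metis
    moreover have "poly ?P (of_real x) = of_real (poly p x)" for x
      by (simp add: poly_altdef degP coeff_map_poly)
    ultimately have "poly p (Re z) = 0"
      by simp
    then show ?thesis
      using that(1) poly_eq_0_iff_dvd by blast
  next
    case False
    define Q where "Q = quad_poly (Re z) \<bar>Im z\<bar>"
    define R where "R = p mod Q"
    have degQ: "degree Q = 2"
      by (simp add: Q_def)
    have evQ: "poly_act (\<lambda>v. z * v) Q v = 0" for v
      unfolding Q_def poly_act_pCons[OF lz] poly_act_0
      by (simp add: complex_eq_iff power2_eq_square algebra_simps)
    have "degree R < 2"
      using degree_mod_less'[of Q p] degQ unfolding R_def by fastforce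
    then have R: "R = [:coeff R 0, coeff R 1:]"
      by (intro poly_eqI) (auto simp: coeff_pCons coeff_eq_0 split: nat.splits)
    have "p = (p div Q) * Q + R"
      by (simp add: R_def)
    then have "ev p = poly_act (\<lambda>v. z * v) (p div Q) (poly_act (\<lambda>v. z * v) Q 1) + ev R"
      unfolding ev_def by (metis poly_act_add poly_act_mult[OF lz])
    then have "ev R = 0"
      using ev evQ linear_0[OF linear_poly_act[OF lz]] by simp
    moreover have "ev R = of_real (coeff R 0) + of_real (coeff R 1) * z"
      unfolding ev_def by (subst R) (simp add: poly_act_pCons[OF lz] scaleR_conv_of_real)
    ultimately have "coeff R 1 = 0" "coeff R 0 = 0"
      using False by (auto simp: complex_eq_iff)
    then have "R = 0"
      by (subst R) simp
    then have "Q dvd p"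
      by (simp add: R_def dvd_eq_mod_eq_0)
    then show ?thesis
      using that(2)[of "\<bar>Im z\<bar>" "Re z"] False by (simp add: Q_def)
  qed
qed

lemma span_image_lessThan:
  fixes w :: "nat \<Rightarrow> 'a::real_vector"
  shows "x \<in> span (w ` {..<k}) \<longleftrightarrow> (\<exists>c. x = (\<Sum>i<k. c i *\<^sub>R w i))"
proof (induction k arbitrary: x)
  case 0
  then show ?case by simp
next
  case (Suc k)
  have "x \<in> span (w ` {..<Suc k}) \<longleftrightarrow> (\<exists>a c. x - a *\<^sub>R w k = (\<Sum>i<k. c i *\<^sub>R w i))"
    by (simp add: lessThan_Suc span_breakdown_eq Suc)
  also have "\<dots> \<longleftrightarrow> (\<exists>c. x = (\<Sum>i<Suc k. c i *\<^sub>R w i))"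
  proof safe
    fix a c assume "x - a *\<^sub>R w k = (\<Sum>i<k. c i *\<^sub>R w i)"
    then have "x = (\<Sum>i<Suc k. (c(k := a)) i *\<^sub>R w i)"
      by (simp add: algebra_simps)
    then show "\<exists>c. x = (\<Sum>i<Suc k. c i *\<^sub>R w i)" by (rule exI[where x = "c(k := a)"])
  next
    fix c :: "nat \<Rightarrow> real"
    have "(\<Sum>i<Suc k. c i *\<^sub>R w i) - c k *\<^sub>R w k = (\<Sum>i<k. c i *\<^sub>R w i)"
      by simp
    then show "\<exists>a d. (\<Sum>i<Suc k. c i *\<^sub>R w i) - a *\<^sub>R w k = (\<Sum>i<k. d i *\<^sub>R w i)"
      by blast
  qed
  finally show ?case .
qed

text \<open>
  The minimal polynomial of a sequence of vectors: it expresses the first vector that depends on its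
  predecessors. It is stated for sequences because two of them matter, the iterates of one vector
  (whose relation has few terms, and is therefore responsible for the bound on the number of
  switchings) and the powers of a matrix (whose relation shows that the spectrum is finite).
\<close>

lemma minimal_linear_relation:
  fixes w :: "nat \<Rightarrow> 'a::euclidean_space"
  obtains p where "lead_coeff p = 1" "(\<Sum>i\<le>degree p. coeff p i *\<^sub>R w i) = 0"
    "degree p \<le> DIM('a)" "dim (w ` {..<degree p}) = degree p"
    "\<And>r. r \<noteq> 0 \<Longrightarrow> degree r < degree p \<Longrightarrow> (\<Sum>i\<le>degree r. coeff r i *\<^sub>R w i) \<noteq> 0"
proof -
  have grow: "dim (w ` {..<k}) = k" if "\<And>j. j < k \<Longrightarrow> w j \<notin> span (w ` {..<j})" for k
    using that by (induction k) (auto simp: lessThan_Suc dim_insert)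
  have "\<exists>k\<le>DIM('a). w k \<in> span (w ` {..<k})"
  proof (rule ccontr)
    assume "\<not> ?thesis"
    then have "dim (w ` {..<Suc DIM('a)}) = Suc DIM('a)"
      by (intro grow) auto
    then show False
      using dim_subset_UNIV[of "w ` {..<Suc DIM('a)}"] by simp
  qed
  define k where "k = (LEAST k. w k \<in> span (w ` {..<k}))"
  have k: "w k \<in> span (w ` {..<k})"
    unfolding k_def using \<open>\<exists>k\<le>_. _\<close> by (metis (mono_tags, lifting) LeastI)
  have min: "w j \<notin> span (w ` {..<j})" if "j < k" for j
    using that not_less_Least unfolding k_def by blast
  have "k \<le> DIM('a)"
    using grow[of k] min dim_subset_UNIV[of "w ` {..<k}"] by simp
  obtain c where c: "w k = (\<Sum>i<k. c i *\<^sub>R w i)"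
    using k span_image_lessThan by blast
  define p where "p = Poly (map (\<lambda>i. - c i) [0..<k] @ [1])"
  have coeff: "coeff p i = (if i < k then - c i else if i = k then 1 else 0)" for i
    by (auto simp: p_def nth_default_def nth_append)
  have deg: "degree p = k"
    by (rule antisym) (auto intro!: degree_le le_degree simp: coeff)
  show thesis
  proof
    show "lead_coeff p = 1"
      by (simp add: deg coeff)
    show "(\<Sum>i\<le>degree p. coeff p i *\<^sub>R w i) = 0"
      by (simp add: deg coeff c sum_negf flip: lessThan_Suc_atMost)
    show "degree p \<le> DIM('a)"
      by (simp add: deg \<open>k \<le> DIM('a)\<close>)
    show "dim (w ` {..<degree p}) = degree p"
      using grow min by (simp add: deg)
    fix r :: "real poly" assume r: "r \<noteq> 0" "degree r < degree p"
    define d where "d = degree r"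
    show "(\<Sum>i\<le>degree r. coeff r i *\<^sub>R w i) \<noteq> 0"
    proof
      assume "(\<Sum>i\<le>degree r. coeff r i *\<^sub>R w i) = 0"
      then have "coeff r d *\<^sub>R w d = (\<Sum>i<d. - coeff r i *\<^sub>R w i)"
        by (simp add: d_def sum_negf eq_neg_iff_add_eq_0 add.commute flip: lessThan_Suc_atMost)
      moreover have "coeff r d \<noteq> 0"
        using r by (simp add: d_def)
      ultimately have "w d = (1 / coeff r d) *\<^sub>R (\<Sum>i<d. - coeff r i *\<^sub>R w i)"
        by (metis divide_inverse mult_1 scaleR_one scaleR_scaleR left_inverse)
      then have "w d \<in> span (w ` {..<d})"
        by (metis span_image_lessThan span_scale)
      then show False
        using min[of d] r deg by (simp add: d_def)
    qed
  qed
qed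

section \<open>Zeros of exponential polynomials on short intervals\<close>

text \<open>
  The zeros of the derivative are located to the left of the largest given zero so that the induction,
  which splits off that zero, yields a further zero beyond those already found.
\<close>

lemma Rolle_zeros:
  fixes h h' :: "real \<Rightarrow> real"
  assumes der: "\<And>t. t \<in> {a<..<b} \<Longrightarrow> (h has_real_derivative h' t) (at t)"
    and "finite Z" "Z \<subseteq> {a<..<b}" "card Z = Suc n" "\<And>z. z \<in> Z \<Longrightarrow> h z = 0"
  shows "\<exists>Z'. finite Z' \<and> Z' \<subseteq> {a<..<Max Z} \<and> card Z' = n \<and> (\<forall>z\<in>Z'. h' z = 0)"
  using assms(2-)
proof (induction n arbitrary: Z)
  case 0
  then show ?case by (intro exI[of _ "{}"]) auto
next
  case (Suc n)
  define m where "m = Max Z"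
  define Y where "Y = Z - {m}"
  have m: "m \<in> Z"
    unfolding m_def using Suc.prems by (intro Max_in) auto
  have Y: "finite Y" "Y \<subseteq> {a<..<b}" "card Y = Suc n" "\<And>z. z \<in> Y \<Longrightarrow> h z = 0"
    using Suc.prems m by (auto simp: Y_def)
  then obtain Y' where Y': "finite Y'" "Y' \<subseteq> {a<..<Max Y}" "card Y' = n" "\<forall>z\<in>Y'. h' z = 0"
    using Suc.IH by blast
  define l where "l = Max Y"
  have l: "l \<in> Y"
    unfolding l_def using Y by (intro Max_in) auto
  have lm: "l < m"
    using l Max_ge[OF Suc.prems(1), of l] by (auto simp: Y_def m_def)
  have ab: "a < l" "m < b"
    using l m Y Suc.prems by auto
  have "\<exists>z. l < z \<and> z < m \<and> DERIV h z :> 0"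
  proof (rule Rolle[OF lm])
    show "h l = h m"
      using l m Y Suc.prems by auto
    show "continuous_on {l..m} h"
      using der ab by (intro continuous_at_imp_continuous_on ballI DERIV_isCont[OF der]) auto
    show "h differentiable (at x)" if "l < x" "x < m" for x
      using der[of x] ab that by (auto simp: real_differentiable_def)
  qed
  then obtain z where z: "l < z" "z < m" "DERIV h z :> 0"
    by blast
  have "h' z = 0"
    using DERIV_unique[OF der z(3)] z ab by auto
  moreover have "card (insert z Y') = Suc n" "insert z Y' \<subseteq> {a<..<m}"
    using Y' z lm ab by (auto simp: l_def[symmetric] card_insert_if)
  ultimately show ?case
    using Y' by (intro exI[of _ "insert z Y'"]) (auto simp: m_def)
qed

lemma zero_derivative_zero:
  fixes h :: "real \<Rightarrow> real"
  assumes "\<And>t. t \<in> {a<..<b} \<Longrightarrow> (h has_real_derivative 0) (at t)"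
    and "z \<in> {a<..<b}" "h z = 0" "t \<in> {a<..<b}"
  shows "h t = 0"
proof -
  have "h t = h z"
    by (rule DERIV_isconst3[of a b]) (use assms in auto)
  then show ?thesis
    using assms by simp
qed

text \<open>
  The functions \<open>F v\<close> are the scalar outputs \<open>t \<mapsto> \<eta> \<bullet> exp (- t L) v\<close> of a linear flow. As the
  derivative of \<open>F v\<close> is \<open>- F (L v)\<close>, applying a constant coefficient differential operator to \<open>F v\<close>
  amounts to applying a polynomial in \<open>L\<close> to the parameter \<open>v\<close>. Arguments about linear differential
  equations thereby become arguments about vectors annihilated by polynomials.
\<close>

locale observed_flow =
  fixes L :: "'v::real_vector \<Rightarrow> 'v" and F :: "'v \<Rightarrow> real \<Rightarrow> real"
  assumes linear_L: "linear L"
    and linear_F: "\<And>t. linear (\<lambda>v. F v t)"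
    and deriv_F: "\<And>v t. (F v has_real_derivative - F (L v) t) (at t)"
begin

lemma deriv_exp_F:
  "((\<lambda>t. exp (c * t) * F v t) has_real_derivative
     - (exp (c * t) * F (poly_act L [:- c, 1:] v) t)) (at t)"
proof -
  have e: "F (L v) t = F (poly_act L [:- c, 1:] v) t + c * F v t"
    using linear_diff[OF linear_F, of "L v" "c *\<^sub>R v" t] linear_cmul[OF linear_F, of c v t]
    by (simp add: poly_act_linear_factor[OF linear_L])
  show ?thesis
    by (auto intro!: derivative_eq_intros deriv_F simp: e algebra_simps)
qed

lemma zero_of_linear_factor:
  assumes "\<And>t. t \<in> {a<..<b} \<Longrightarrow> F (poly_act L [:- c, 1:] v) t = 0"
    and "z \<in> {a<..<b}" "F v z = 0" "t \<in> {a<..<b}"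
  shows "F v t = 0"
proof -
  have "exp (c * t) * F v t = 0"
  proof (rule zero_derivative_zero[of a b "\<lambda>t. exp (c * t) * F v t" z t])
    show "((\<lambda>t. exp (c * t) * F v t) has_real_derivative 0) (at x)" if "x \<in> {a<..<b}" for x
      using deriv_exp_F[of c v x] assms(1)[OF that] by simp
  qed (use assms in auto)
  then show ?thesis by simp
qed

text \<open>
  The operator \<open>(D - c)\<^sup>2 + \<omega>\<^sup>2\<close> has the solution \<open>s = sin (\<omega> (t - a))\<close>, up to an exponential
  factor, and \<open>s\<close> is positive on an interval \<open>(a, b)\<close> of length at most \<open>\<pi> / \<omega>\<close>. There the operator
  factors through two differentiations: with \<open>h = exp (c t) F v\<close> one has
  \<open>(h / s)' = W / s\<^sup>2\<close> and \<open>W' = s (h'' + \<omega>\<^sup>2 h)\<close>. Rolle's theorem applied to \<open>h / s\<close> and to \<open>W\<close> loses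
  two zeros; read backwards, if the operator kills \<open>F v\<close>, then \<open>W\<close> and \<open>h / s\<close> are constants that
  vanish somewhere. This is the place where the bound on the length of the interval enters.
\<close>

lemma quad_factor_step:
  fixes c :: real
  assumes \<omega>: "0 < \<omega>" "\<omega> * (b - a) \<le> pi"
    and Z: "finite Z" "Z \<subseteq> {a<..<b}" "card Z = Suc (Suc n)" "\<And>z. z \<in> Z \<Longrightarrow> F v z = 0"
  defines "v2 \<equiv> poly_act L (quad_poly c \<omega>) v"
  shows "\<exists>Z'. finite Z' \<and> Z' \<subseteq> {a<..<b} \<and> card Z' = n \<and> (\<forall>z\<in>Z'. F v2 z = 0)"
    and "(\<forall>t\<in>{a<..<b}. F v2 t = 0) \<Longrightarrow> t \<in> {a<..<b} \<Longrightarrow> F v t = 0"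
proof -
  define v1 where "v1 = poly_act L [:- c, 1:] v"
  define h where "h t = exp (c * t) * F v t" for t
  define h1 where "h1 t = - (exp (c * t) * F v1 t)" for t
  \<comment> \<open>A positive solution of \<open>s'' + \<omega>\<^sup>2 s = 0\<close>, and the Wronskian \<open>W\<close> of \<open>h\<close> with it.\<close>
  define s where "s t = sin (\<omega> * (t - a))" for t
  define s1 where "s1 t = \<omega> * cos (\<omega> * (t - a))" for t
  define W where "W t = h1 t * s t - h t * s1 t" for t
  have h: "(h has_real_derivative h1 t) (at t)" for t
    using deriv_exp_F unfolding h_def h1_def v1_def .
  have "v2 = poly_act L [:- c, 1:] v1 + \<omega>\<^sup>2 *\<^sub>R v"
    unfolding v2_def v1_def by (rule poly_act_quad_poly[OF linear_L])
  then have Fv2: "F v2 t = F (poly_act L [:- c, 1:] v1) t + \<omega>\<^sup>2 * F v t" for t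
    using linear_add[OF linear_F] linear_cmul[OF linear_F, of "\<omega>\<^sup>2" v t] by simp
  have h1: "(h1 has_real_derivative exp (c * t) * F v2 t - \<omega>\<^sup>2 * h t) (at t)" for t
    using DERIV_minus[OF deriv_exp_F[of c v1 t]] unfolding h1_def h_def Fv2
    by (simp add: algebra_simps)
  have s: "(s has_real_derivative s1 t) (at t)" for t
    unfolding s_def s1_def by (auto intro!: derivative_eq_intros)
  have s1: "(s1 has_real_derivative - (\<omega>\<^sup>2 * s t)) (at t)" for t
    unfolding s_def s1_def by (auto intro!: derivative_eq_intros simp: power2_eq_square)
  have spos: "s t > 0" if "t \<in> {a<..<b}" for t
  proof -
    have "0 < \<omega> * (t - a)" "\<omega> * (t - a) < \<omega> * (b - a)"
      using that \<omega>(1) by (auto intro: mult_strict_left_mono)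
    then show ?thesis
      unfolding s_def using \<omega>(2) by (intro sin_gt_zero) linarith+
  qed
  have W: "(W has_real_derivative s t * exp (c * t) * F v2 t) (at t)" for t
    unfolding W_def
    by (rule DERIV_cong[OF DERIV_diff[OF DERIV_mult[OF h1 s] DERIV_mult[OF h s1]]])
      (simp add: algebra_simps)
  have q: "((\<lambda>t. h t / s t) has_real_derivative W t / (s t)\<^sup>2) (at t)" if "t \<in> {a<..<b}" for t
    using spos[OF that] unfolding W_def power2_eq_square
    by (intro DERIV_divide h s) auto
  obtain Z1 where Z1: "finite Z1" "Z1 \<subseteq> {a<..<Max Z}" "card Z1 = Suc n"
      "\<forall>z\<in>Z1. W z / (s z)\<^sup>2 = 0"
    using Rolle_zeros[OF q Z(1-3)] Z(4) by (auto simp: h_def)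
  have "Max Z \<in> Z"
    using Z by (intro Max_in) auto
  then have "Max Z < b"
    using Z by auto
  then have Z1': "Z1 \<subseteq> {a<..<b}"
    using Z1 by force
  have WZ1: "W z = 0" if "z \<in> Z1" for z
  proof -
    have "s z > 0" using that Z1' by (intro spos) auto
    then show ?thesis using Z1(4) that by fastforce
  qed
  obtain Z2 where Z2: "finite Z2" "Z2 \<subseteq> {a<..<Max Z1}" "card Z2 = n"
      "\<forall>z\<in>Z2. s z * exp (c * z) * F v2 z = 0"
    using Rolle_zeros[OF W Z1(1) Z1' Z1(3) WZ1] by blast
  have "Max Z1 \<in> Z1"
    using Z1 by (intro Max_in) auto
  then have "Max Z1 < b"
    using Z1' by auto
  then have Z2': "Z2 \<subseteq> {a<..<b}"
    using Z2 by force
  have "F v2 z = 0" if "z \<in> Z2" for z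
  proof -
    have "s z > 0" using that Z2' by (intro spos) auto
    then show ?thesis using Z2(4) that by fastforce
  qed
  then show "\<exists>Z'. finite Z' \<and> Z' \<subseteq> {a<..<b} \<and> card Z' = n \<and> (\<forall>z\<in>Z'. F v2 z = 0)"
    using Z2 Z2' by blast
  assume v2: "\<forall>t\<in>{a<..<b}. F v2 t = 0" and t: "t \<in> {a<..<b}"
  obtain z1 where "z1 \<in> Z1"
    using Z1 by fastforce
  have W0: "W x = 0" if "x \<in> {a<..<b}" for x
  proof (rule zero_derivative_zero[of a b W z1 x])
    show "(W has_real_derivative 0) (at y)" if "y \<in> {a<..<b}" for y
      using W[of y] v2 that by simp
    show "z1 \<in> {a<..<b}" "W z1 = 0"
      using \<open>z1 \<in> Z1\<close> Z1' WZ1 by auto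
  qed (rule that)
  obtain z where "z \<in> Z"
    using Z by fastforce
  have "h t / s t = 0"
  proof (rule zero_derivative_zero[of a b "\<lambda>t. h t / s t" z t])
    show "((\<lambda>t. h t / s t) has_real_derivative 0) (at y)" if "y \<in> {a<..<b}" for y
      using q[OF that] W0[OF that] by simp
    show "z \<in> {a<..<b}" "h z / s z = 0"
      using \<open>z \<in> Z\<close> Z by (auto simp: h_def)
  qed (rule t)
  then show "F v t = 0"
    using spos[OF t] by (auto simp: h_def)
qed

text \<open>
  Let \<open>p = r f\<close> with \<open>f\<close> real, of degree one or two. The \<open>degree p\<close> zeros of \<open>F v\<close>
  yield \<open>degree r\<close> zeros of \<open>F w\<close> for \<open>w = f(L) v\<close>, by as many applications of Rolle's theorem as the
  degree of \<open>f\<close>. By induction \<open>F w\<close> vanishes, and then so does \<open>F v\<close>, having a zero itself. This contrapositive form of the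
  bound on the number of zeros is the one that passes through the induction.
\<close>

theorem zero_bound:
  assumes "p \<noteq> 0" "poly_act L p v = 0"
    and "\<And>c \<omega>. 0 < \<omega> \<Longrightarrow> quad_poly c \<omega> dvd p \<Longrightarrow> \<omega> * (b - a) \<le> pi"
    and "finite Z" "Z \<subseteq> {a<..<b}" "card Z = degree p" "\<And>z. z \<in> Z \<Longrightarrow> F v z = 0"
    and "t \<in> {a<..<b}"
  shows "F v t = 0"
  using assms
proof (induction "degree p" arbitrary: p v Z t rule: less_induct)
  case less
  show ?case
  proof (cases "degree p = 0")
    case True
    then obtain k where "p = [:k:]" "k \<noteq> 0"
      using less.prems(1) by (metis degree_eq_zeroE pCons_0_0)
    then have "v = 0"
      using less.prems(2) by (simp add: poly_act_pCons[OF linear_L] linear_0[OF linear_L])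
    then show ?thesis
      using linear_0[OF linear_F] by simp
  next
    case False
    then have "degree p > 0" by simp
    then show ?thesis
    proof (cases rule: real_poly_factor_cases)
      case (1 l)
      then obtain r where r: "p = r * [:- l, 1:]"
        by (metis dvd_def mult.commute)
      with less.prems(1) have r0: "r \<noteq> 0" by auto
      then have deg: "degree p = Suc (degree r)"
        unfolding r by (subst degree_mult_eq) auto
      define w where "w = poly_act L [:- l, 1:] v"
      have "card Z = Suc (degree r)"
        using less.prems(6) deg by simp
      from Rolle_zeros[OF deriv_exp_F less.prems(4,5) this, of l v] less.prems(7)
      obtain Z' where Z': "finite Z'" "Z' \<subseteq> {a<..<Max Z}" "card Z' = degree r"
          "\<And>z. z \<in> Z' \<Longrightarrow> F w z = 0"
        unfolding w_def by auto
      have "Max Z \<in> Z"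
        using less.prems(4) \<open>card Z = Suc (degree r)\<close> by (intro Max_in) auto
      then have "Max Z < b" "Max Z \<in> {a<..<b}"
        using less.prems(5) by auto
      have "F w t = 0" if "t \<in> {a<..<b}" for t
      proof (rule less.hyps[OF _ r0 _ _ Z'(1) _ Z'(3) Z'(4) that])
        show "degree r < degree p"
          by (simp add: deg)
        show "poly_act L r w = 0"
          using less.prems(2) unfolding r w_def by (simp only: poly_act_mult[OF linear_L])
        show "\<omega> * (b - a) \<le> pi" if "0 < \<omega>" "quad_poly c \<omega> dvd r" for c \<omega>
          using less.prems(3)[OF that(1), of c] that(2) unfolding r by (simp only: dvd_mult2)
        show "Z' \<subseteq> {a<..<b}"
          using Z' \<open>Max Z < b\<close> by force
      qed auto
      then show ?thesis
        using zero_of_linear_factor[of a b l v "Max Z" t] \<open>Max Z \<in> {a<..<b}\<close> \<open>Max Z \<in> Z\<close>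
          less.prems(7,8) unfolding w_def by blast
    next
      case (2 c \<omega>)
      obtain r where "p = quad_poly c \<omega> * r"
        using 2(2) by (rule dvdE)
      then have r: "p = r * quad_poly c \<omega>"
        by (simp only: mult.commute)
      with less.prems(1) have r0: "r \<noteq> 0" by auto
      then have deg: "degree p = Suc (Suc (degree r))"
        unfolding r by (subst degree_mult_eq) auto
      define w where "w = poly_act L (quad_poly c \<omega>) v"
      have bd: "\<omega> * (b - a) \<le> pi"
        using less.prems(3) 2 .
      have cardZ: "card Z = Suc (Suc (degree r))"
        using less.prems(6) deg by simp
      note step = quad_factor_step[OF 2(1) bd less.prems(4,5) cardZ less.prems(7), of c, folded w_def]
      from step(1) obtain Z' where Z': "finite Z'" "Z' \<subseteq> {a<..<b}" "card Z' = degree r"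
          "\<And>z. z \<in> Z' \<Longrightarrow> F w z = 0"
        by auto
      have "F w t = 0" if "t \<in> {a<..<b}" for t
      proof (rule less.hyps[OF _ r0 _ _ Z' that])
        show "degree r < degree p"
          by (simp add: deg)
        show "poly_act L r w = 0"
          using less.prems(2) unfolding r w_def by (simp only: poly_act_mult[OF linear_L])
        show "\<omega> * (b - a) \<le> pi" if "0 < \<omega>" "quad_poly c \<omega> dvd r" for c \<omega>
          using less.prems(3)[OF that(1), of c] that(2) unfolding r by (simp only: dvd_mult2)
      qed auto
      then show ?thesis
        using step(2) less.prems(8) by blast
    qed
  qed
qed

text \<open>
  Taylor's formula at a zero of order at least \<open>k\<close>: the \<open>k\<close>-th derivative of \<open>F v\<close> at \<open>s\<close> is
  \<open>(- 1) ^ k * F ((L ^^ k) v) s\<close>.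
\<close>

lemma tendsto_power_quotient:
  assumes "\<And>i. i < k \<Longrightarrow> F ((L ^^ i) v) s = 0"
  shows "((\<lambda>t. F v t / (t - s) ^ k) \<longlongrightarrow> (- 1) ^ k * F ((L ^^ k) v) s / fact k) (at s)"
  using assms
proof (induction k arbitrary: v)
  case 0
  have "isCont (F v) s"
    by (rule DERIV_isCont[OF deriv_F])
  then show ?case
    by (simp add: isCont_def)
next
  case (Suc k)
  have lim: "((\<lambda>t. F (L v) t / (t - s) ^ k) \<longlongrightarrow> (- 1) ^ k * F ((L ^^ k) (L v)) s / fact k) (at s)"
    using Suc.prems[of "Suc _"] by (intro Suc.IH) (simp add: funpow_swap1)
  have "isCont (F v) s"
    by (rule DERIV_isCont[OF deriv_F])
  then have F0: "(F v \<longlongrightarrow> 0) (at s)"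
    using Suc.prems[of 0] by (simp add: isCont_def)
  show ?case
  proof (rule lhopital[OF F0])
    show "((\<lambda>t. (t - s) ^ Suc k) \<longlongrightarrow> 0) (at s)"
      by (auto intro!: tendsto_eq_intros)
    show "\<forall>\<^sub>F t in at s. (t - s) ^ Suc k \<noteq> 0"
      using eventually_neq_at_within[of s s UNIV] by eventually_elim simp
    show "\<forall>\<^sub>F t in at s. real (Suc k) * (t - s) ^ k \<noteq> 0"
      using eventually_neq_at_within[of s s UNIV] by eventually_elim simp
    show "\<forall>\<^sub>F t in at s. DERIV (F v) t :> - F (L v) t"
      using deriv_F by simp
    show "\<forall>\<^sub>F t in at s. DERIV (\<lambda>t. (t - s) ^ Suc k) t :> real (Suc k) * (t - s) ^ k"
      by (intro always_eventually allI
          DERIV_cong[OF DERIV_power_Suc[OF DERIV_diff[OF DERIV_ident DERIV_const]]]) simp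
    have "((\<lambda>t. - (1 / real (Suc k)) * (F (L v) t / (t - s) ^ k)) \<longlongrightarrow>
        - (1 / real (Suc k)) * ((- 1) ^ k * F ((L ^^ k) (L v)) s / fact k)) (at s)"
      by (intro tendsto_intros lim)
    moreover have "(\<lambda>t. - (1 / real (Suc k)) * (F (L v) t / (t - s) ^ k))
        = (\<lambda>t. - F (L v) t / (real (Suc k) * (t - s) ^ k))"
      by (intro ext) (simp del: of_nat_Suc)
    ultimately show "((\<lambda>t. - F (L v) t / (real (Suc k) * (t - s) ^ k)) \<longlongrightarrow>
        (- 1) ^ Suc k * F ((L ^^ Suc k) v) s / fact (Suc k)) (at s)"
      by (simp add: funpow_swap1 fact_Suc mult.commute del: of_nat_Suc)
  qed
qed

end

section \<open>Spectrum and annihilating polynomials of a matrix\<close>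

lemma linear_matrix_action: "linear ((*v) (A :: real^'n^'n))"
  by (rule matrix_vector_mul_linear)

lemma map_matrix_of_real_mult_Complex:
  fixes A :: "real^'n^'n"
  shows "map_matrix complex_of_real A *v (\<chi> i. Complex (x $ i) (y $ i)) =
    (\<chi> i. Complex ((A *v x) $ i) ((A *v y) $ i))"
  by (simp add: vec_eq_iff matrix_vector_mult_def complex_eq_iff)

text \<open>
  If \<open>p = ((x - c)\<^sup>2 + \<omega>\<^sup>2) r\<close> annihilates \<open>b\<close> and no polynomial of smaller degree does, then
  \<open>w = r(A) b\<close> is a nonzero vector with \<open>((A - c)\<^sup>2 + \<omega>\<^sup>2) w = 0\<close>, and the other complex factor
  \<open>z = (A - c) w + i \<omega> w\<close> is an eigenvector for \<open>c + i \<omega>\<close>.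
\<close>

lemma quad_factor_eigenvalue:
  fixes A :: "real^'n^'n"
  assumes p: "p \<noteq> 0" "poly_act ((*v) A) p b = 0"
    and min: "\<And>r. r \<noteq> 0 \<Longrightarrow> degree r < degree p \<Longrightarrow> poly_act ((*v) A) r b \<noteq> 0"
    and \<omega>: "0 < \<omega>" and dvd: "quad_poly c \<omega> dvd p"
  shows "Complex c \<omega> \<in> complex_spectrum A"
proof -
  note lA = linear_matrix_action[of A]
  obtain r where r: "p = quad_poly c \<omega> * r"
    using dvd by (rule dvdE)
  have r0: "r \<noteq> 0"
    using p r by auto
  have "degree p = degree (quad_poly c \<omega>) + degree r"
    unfolding r by (rule degree_mult_eq) (use r0 in auto)
  then have "degree r < degree p"
    by simp
  define w where "w = poly_act ((*v) A) r b"
  have w0: "w \<noteq> 0"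
    unfolding w_def by (rule min) fact+
  define w1 where "w1 = A *v w - c *\<^sub>R w"
  have "poly_act ((*v) A) (quad_poly c \<omega>) w = 0"
    using p(2) unfolding r w_def poly_act_mult[OF lA] .
  then have "A *v w1 - c *\<^sub>R w1 + \<omega>\<^sup>2 *\<^sub>R w = 0"
    unfolding poly_act_quad_poly[OF lA] poly_act_linear_factor[OF lA] w1_def .
  then have Aw1: "A *v w1 = c *\<^sub>R w1 - \<omega>\<^sup>2 *\<^sub>R w"
    by (simp add: algebra_simps eq_neg_iff_add_eq_0)
  have Aw: "A *v w = w1 + c *\<^sub>R w"
    by (simp add: w1_def)
  define z :: "complex^'n" where "z = (\<chi> i. Complex (w1 $ i) ((\<omega> *\<^sub>R w) $ i))"
  have "map_matrix complex_of_real A *v z = Complex c \<omega> *s z"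
    unfolding z_def map_matrix_of_real_mult_Complex matrix_vector_mult_scaleR Aw1 Aw
    by (simp add: vec_eq_iff complex_eq_iff power2_eq_square algebra_simps)
  moreover have "z \<noteq> 0"
  proof -
    obtain i where "w $ i \<noteq> 0"
      using w0 by (auto simp: vec_eq_iff)
    then have "z $ i \<noteq> 0"
      using \<omega> by (simp add: z_def complex_eq_iff)
    then show ?thesis by auto
  qed
  ultimately show ?thesis
    unfolding complex_spectrum_def by blast
qed

definition mpow :: "real^'n^'n \<Rightarrow> nat \<Rightarrow> real^'n^'n" where
  "mpow A k = (((**) A) ^^ k) (mat 1)"

lemma mpow_0 [simp]: "mpow A 0 = mat 1"
  by (simp add: mpow_def)

lemma mpow_Suc: "mpow A (Suc k) = A ** mpow A k"
  by (simp add: mpow_def)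

lemma mpow_Suc2: "mpow A (Suc k) = mpow A k ** A"
proof (induction k)
  case 0
  then show ?case by (simp add: mpow_Suc)
next
  case (Suc k)
  then show ?case by (metis mpow_Suc matrix_mul_assoc)
qed

lemma mpow_mult_vector: "mpow A k *v v = (((*v) A) ^^ k) v"
  by (induction k) (simp_all add: mpow_Suc flip: matrix_vector_mul_assoc)

text \<open>
  Every eigenvalue is a root of a nonzero polynomial that annihilates \<open>A\<close>. Finiteness matters because
  \<^const>\<open>d_const\<close> is a \<^const>\<open>Min\<close>, which is a lower bound only for a finite set.
\<close>

lemma finite_complex_spectrum: "finite (complex_spectrum (A :: real^'n^'n))"
proof -
  obtain p where p: "lead_coeff p = 1" "(\<Sum>i\<le>degree p. coeff p i *\<^sub>R mpow A i) = 0"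
    by (rule minimal_linear_relation[of "mpow A"])
  define P where "P = map_poly complex_of_real p"
  have "coeff P (degree p) = 1"
    using p(1) by (simp add: P_def coeff_map_poly)
  then have "P \<noteq> 0"
    by auto
  have "poly P l = 0" if l: "l \<in> complex_spectrum A" for l
  proof -
    let ?A = "map_matrix complex_of_real A"
    obtain v where v: "v \<noteq> 0" "?A *v v = l *s v"
      using l by (auto simp: complex_spectrum_def)
    have pw: "map_matrix complex_of_real (mpow A k) *v v = l ^ k *s v" for k
    proof (induction k)
      case 0
      have "map_matrix complex_of_real (mat 1 :: real^'n^'n) = mat 1"
        by (simp add: vec_eq_iff mat_def)
      then show ?case by simp
    next
      case (Suc k)
      have "map_matrix complex_of_real (A ** mpow A k) = ?A ** map_matrix complex_of_real (mpow A k)"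
        by (simp add: vec_eq_iff matrix_matrix_mult_def)
      then show ?case
        using Suc v(2)
        by (simp add: mpow_Suc vector_scalar_commute mult.commute flip: matrix_vector_mul_assoc)
    qed
    have "(map_matrix complex_of_real (\<Sum>i\<le>degree p. coeff p i *\<^sub>R mpow A i) *v v) $ j
        = (\<Sum>i\<le>degree p. of_real (coeff p i) * (map_matrix complex_of_real (mpow A i) *v v) $ j)" for j
      by (simp add: matrix_vector_mult_def sum_distrib_left sum_distrib_right mult.assoc)
        (rule sum.swap)
    then have "(\<Sum>i\<le>degree p. of_real (coeff p i) * (l ^ i * v $ j)) = 0" for j
      unfolding p(2) pw by (simp add: matrix_vector_mult_def)
    then have "poly P l * v $ j = 0" for j
      by (simp add: P_def poly_altdef degree_map_poly coeff_map_poly sum_distrib_right mult.assoc)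
    then show ?thesis
      using v(1) by (auto simp: vec_eq_iff)
  qed
  then have "complex_spectrum A \<subseteq> {l. poly P l = 0}"
    by auto
  then show ?thesis
    using poly_roots_finite[OF \<open>P \<noteq> 0\<close>] by (rule finite_subset)
qed

lemma d_const_le:
  assumes "Complex c \<omega> \<in> complex_spectrum A" "0 < \<omega>"
  shows "d_const A \<le> ereal (pi / \<omega>)"
proof -
  have "d_const A \<le> ereal pi / ereal \<bar>Im (Complex c \<omega>)\<bar>"
    unfolding d_const_def by (intro Min_le finite_imageI finite_complex_spectrum imageI assms)
  also have "\<dots> = ereal (pi / \<omega>)"
    using assms(2) by simp
  finally show ?thesis .
qed

text \<open>
  The link between the two constants of the problem: the annihilator of \<open>b\<close> of least degree has at most
  the dimension of the Krylov space as its degree, and its non-real roots are eigenvalues of \<open>A\<close>, hence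
  subject to the bound expressed by \<^const>\<open>d_const\<close>. Real eigenvalues impose no bound, in
  agreement with \<open>\<pi> / 0 = \<infinity>\<close>.
\<close>

lemma krylov_annihilator:
  fixes A :: "real^'n^'n" and b :: "real^'n"
  obtains p where "p \<noteq> 0" "poly_act ((*v) A) p b = 0" "degree p \<le> dim (krylov A b)"
    "\<And>c \<omega>. 0 < \<omega> \<Longrightarrow> quad_poly c \<omega> dvd p \<Longrightarrow> d_const A \<le> ereal (pi / \<omega>)"
proof -
  let ?w = "\<lambda>i. (((*v) A) ^^ i) b"
  obtain p where p: "lead_coeff p = 1" "(\<Sum>i\<le>degree p. coeff p i *\<^sub>R ?w i) = 0"
    "degree p \<le> DIM(real^'n)" "dim (?w ` {..<degree p}) = degree p"
    "\<And>r. r \<noteq> 0 \<Longrightarrow> degree r < degree p \<Longrightarrow> (\<Sum>i\<le>degree r. coeff r i *\<^sub>R ?w i) \<noteq> 0"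
    by (rule minimal_linear_relation[of ?w]) blast
  show thesis
  proof
    show p0: "p \<noteq> 0"
      using p(1) by auto
    show pb: "poly_act ((*v) A) p b = 0"
      using p(2) by (simp add: poly_act_def)
    have "?w ` {..<degree p} \<subseteq> ?w ` {..<CARD('n)}"
      using p(3) by (intro image_mono) auto
    then have "dim (?w ` {..<degree p}) \<le> dim (krylov A b)"
      unfolding krylov_def dim_span by (rule dim_subset)
    then show "degree p \<le> dim (krylov A b)"
      using p(4) by simp
    fix c \<omega> :: real assume "0 < \<omega>" "quad_poly c \<omega> dvd p"
    then show "d_const A \<le> ereal (pi / \<omega>)"
      using p(5) by (intro d_const_le quad_factor_eigenvalue[OF p0 pb]) (auto simp: poly_act_def)
  qed
qed

section \<open>The matrix exponential\<close>

text \<open>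
  The exponential \<open>exp (t A)\<close>. It is defined by scalar power series, one for each entry, so that the
  theorem on termwise differentiation of scalar power series gives its derivative.
\<close>

definition mexp :: "real^'n^'n \<Rightarrow> real \<Rightarrow> real^'n^'n" where
  "mexp A t = (\<chi> i j. \<Sum>k. (mpow A k $ i $ j / fact k) * t ^ k)"

lemma mpow_entry_le:
  fixes A :: "real^'n^'n"
  defines "K \<equiv> (\<Sum>i\<in>UNIV. \<Sum>j\<in>UNIV. \<bar>A $ i $ j\<bar>)"
  shows "\<bar>mpow A k $ i $ j\<bar> \<le> K ^ k"
proof (induction k arbitrary: i j)
  case 0
  then show ?case by (simp add: mat_def)
next
  case (Suc k)
  have K0: "K \<ge> 0"
    unfolding K_def by (intro sum_nonneg) auto
  have "\<bar>mpow A (Suc k) $ i $ j\<bar> \<le> (\<Sum>l\<in>UNIV. \<bar>A $ i $ l\<bar> * \<bar>mpow A k $ l $ j\<bar>)"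
    by (simp add: mpow_Suc matrix_matrix_mult_def flip: abs_mult)
  also have "\<dots> \<le> (\<Sum>l\<in>UNIV. \<bar>A $ i $ l\<bar> * K ^ k)"
    by (intro sum_mono mult_left_mono Suc) auto
  also have "\<dots> = (\<Sum>l\<in>UNIV. \<bar>A $ i $ l\<bar>) * K ^ k"
    by (simp add: sum_distrib_right)
  also have "\<dots> \<le> K * K ^ k"
    unfolding K_def
    by (intro mult_right_mono member_le_sum[where f = "\<lambda>i. \<Sum>l\<in>UNIV. \<bar>A $ i $ l\<bar>"])
      (auto intro!: sum_nonneg zero_le_power)
  finally show ?case by simp
qed

lemma summable_mexp_entry: "summable (\<lambda>k. (mpow A k $ i $ j / fact k) * t ^ k)"
proof (rule summable_comparison_test')
  let ?K = "\<Sum>i\<in>UNIV. \<Sum>j\<in>UNIV. \<bar>A $ i $ j\<bar>"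
  show "summable (\<lambda>k. inverse (fact k) * (?K * \<bar>t\<bar>) ^ k)"
    by (rule summable_exp)
  fix k :: nat
  have "norm ((mpow A k $ i $ j / fact k) * t ^ k) = inverse (fact k) * (\<bar>mpow A k $ i $ j\<bar> * \<bar>t\<bar> ^ k)"
    by (simp add: abs_mult power_abs divide_inverse)
  also have "\<dots> \<le> inverse (fact k) * (?K ^ k * \<bar>t\<bar> ^ k)"
    by (intro mult_left_mono mult_right_mono mpow_entry_le zero_le_power sum_nonneg) auto
  finally show "norm ((mpow A k $ i $ j / fact k) * t ^ k) \<le> inverse (fact k) * (?K * \<bar>t\<bar>) ^ k"
    by (simp add: power_mult_distrib)
qed

lemma mexp_entry_sums: "(\<lambda>k. (mpow A k $ i $ j / fact k) * t ^ k) sums (mexp A t $ i $ j)"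
  using summable_sums[OF summable_mexp_entry] by (simp add: mexp_def)

lemma mexp_entry_deriv:
  "((\<lambda>t. mexp A t $ i $ j) has_real_derivative
     (\<Sum>k. (mpow A (Suc k) $ i $ j / fact k) * t ^ k)) (at t)"
proof -
  have "diffs (\<lambda>k. mpow A k $ i $ j / fact k) = (\<lambda>k. mpow A (Suc k) $ i $ j / fact k)"
    by (simp add: diffs_def fun_eq_iff field_simps del: of_nat_Suc)
  then show ?thesis
    using termdiffs_strong_converges_everywhere[OF summable_mexp_entry, of A i j t]
    by (simp add: mexp_def)
qed

lemma suminf_mpow_Suc:
  "(\<Sum>k. (mpow A (Suc k) $ i $ j / fact k) * t ^ k) = (A ** mexp A t) $ i $ j"
  "(\<Sum>k. (mpow A (Suc k) $ i $ j / fact k) * t ^ k) = (mexp A t ** A) $ i $ j"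
proof -
  note s = mexp_entry_sums
  have "(\<lambda>k. \<Sum>l\<in>UNIV. A $ i $ l * ((mpow A k $ l $ j / fact k) * t ^ k)) sums (A ** mexp A t) $ i $ j"
    unfolding matrix_matrix_mult_def vec_lambda_beta by (intro sums_sum sums_mult s)
  moreover have "(\<lambda>k. \<Sum>l\<in>UNIV. A $ i $ l * ((mpow A k $ l $ j / fact k) * t ^ k))
      = (\<lambda>k. (mpow A (Suc k) $ i $ j / fact k) * t ^ k)"
    by (simp add: mpow_Suc matrix_matrix_mult_def sum_divide_distrib sum_distrib_right mult.assoc)
  ultimately show "(\<Sum>k. (mpow A (Suc k) $ i $ j / fact k) * t ^ k) = (A ** mexp A t) $ i $ j"
    by (simp add: sums_iff)
  have "(\<lambda>k. \<Sum>l\<in>UNIV. (mpow A k $ i $ l / fact k) * t ^ k * A $ l $ j) sums (mexp A t ** A) $ i $ j"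
    unfolding matrix_matrix_mult_def vec_lambda_beta by (intro sums_sum sums_mult2 s)
  moreover have "(\<lambda>k. \<Sum>l\<in>UNIV. (mpow A k $ i $ l / fact k) * t ^ k * A $ l $ j)
      = (\<lambda>k. (mpow A (Suc k) $ i $ j / fact k) * t ^ k)"
    by (simp add: mpow_Suc2 matrix_matrix_mult_def sum_divide_distrib sum_distrib_left sum_distrib_right mult_ac)
  ultimately show "(\<Sum>k. (mpow A (Suc k) $ i $ j / fact k) * t ^ k) = (mexp A t ** A) $ i $ j"
    by (simp add: sums_iff)
qed

lemma mexp_commute: "A ** mexp A t = mexp A t ** A"
  by (simp add: vec_eq_iff flip: suminf_mpow_Suc)

lemma has_vector_derivative_componentwiseI:
  fixes f :: "real \<Rightarrow> 'a::euclidean_space ^ 'n"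
  assumes "\<And>i. ((\<lambda>t. f t $ i) has_vector_derivative D $ i) F"
  shows "(f has_vector_derivative D) F"
proof -
  have ax: "x = (\<Sum>i\<in>UNIV. axis i (x $ i))" for x :: "'a ^ 'n"
    by (simp add: vec_eq_iff axis_def)
  have bl: "bounded_linear (axis i :: 'a \<Rightarrow> 'a ^ 'n)" for i
    by (intro linear_conv_bounded_linear[THEN iffD1] linearI) (auto simp: vec_eq_iff axis_def)
  have "((\<lambda>t. \<Sum>i\<in>UNIV. axis i (f t $ i)) has_vector_derivative (\<Sum>i\<in>UNIV. axis i (D $ i))) F"
    by (rule has_vector_derivative_sum) (rule bounded_linear.has_vector_derivative[OF bl assms])
  then show ?thesis
    by (simp only: ax[symmetric])
qed

lemma mexp_deriv: "(mexp A has_vector_derivative A ** mexp A t) (at t)"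
  using mexp_entry_deriv unfolding suminf_mpow_Suc(1)
  by (intro has_vector_derivative_componentwiseI) (simp flip: has_real_derivative_iff_has_vector_derivative)

lemma mexp_minus_deriv: "((\<lambda>t. mexp A (- t)) has_vector_derivative - (mexp A (- t) ** A)) (at t)"
proof -
  have "(uminus has_vector_derivative (-1)) (at t)"
    by (auto intro!: derivative_eq_intros simp flip: has_real_derivative_iff_has_vector_derivative)
  from vector_diff_chain_at[OF this mexp_deriv, of A] show ?thesis
    by (simp add: o_def mexp_commute)
qed

lemma mexp_0 [simp]: "mexp A 0 = mat 1"
  by (simp add: vec_eq_iff mexp_def powser_zero del: times_divide_eq_left)

lemma bounded_bilinear_matrix_vector_mult:
  "bounded_bilinear ((*v) :: real^'n^'m \<Rightarrow> real^'n \<Rightarrow> real^'m)"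
  unfolding bilinear_conv_bounded_bilinear[symmetric] bilinear_def
  by (auto intro!: linearI simp: algebra_simps scaleR_matrix_vector_assoc)

lemma bounded_bilinear_matrix_matrix_mult:
  "bounded_bilinear ((**) :: real^'n^'m \<Rightarrow> real^'k^'n \<Rightarrow> real^'k^'m)"
  unfolding bilinear_conv_bounded_bilinear[symmetric] bilinear_def
  by (auto intro!: linearI
      simp: vec_eq_iff matrix_matrix_mult_def sum.distrib sum_distrib_left algebra_simps)

text \<open>
  The derivative of \<open>t \<mapsto> exp (t A) exp (- t A)\<close> is zero.
\<close>

lemma mexp_inverse: "mexp A t ** mexp A (- t) = mat 1"
proof -
  let ?g = "\<lambda>t. mexp A t ** mexp A (- t)"
  have "(?g has_vector_derivative 0) (at t within UNIV)" for t
  proof -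
    have "(?g has_vector_derivative
        mexp A t ** - (mexp A (- t) ** A) + (A ** mexp A t) ** mexp A (- t)) (at t)"
      by (rule bounded_bilinear.has_vector_derivative[OF bounded_bilinear_matrix_matrix_mult
            mexp_deriv mexp_minus_deriv])
    moreover have "mexp A t ** - (mexp A (- t) ** A) + (A ** mexp A t) ** mexp A (- t) = 0"
      by (simp add: mexp_commute[of A t] mexp_commute[of A "- t", symmetric] matrix_mul_assoc
          bounded_bilinear.minus_right[OF bounded_bilinear_matrix_matrix_mult])
    ultimately show ?thesis by simp
  qed
  then obtain c where "?g x = c" for x
    using has_vector_derivative_zero_constant[of UNIV ?g] by auto
  from this[of t] this[of 0] show ?thesis by simp
qed

lemma mexp_invariant_subspace:
  fixes A :: "real^'n^'n"
  assumes "subspace W" "\<And>w. w \<in> W \<Longrightarrow> A *v w \<in> W" "v \<in> W"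
  shows "mexp A t *v v \<in> W"
proof (rule Lim_in_closed_set[OF closed_subspace[OF assms(1)]])
  let ?S = "\<lambda>n. \<Sum>k<n. (t ^ k / fact k) *\<^sub>R mpow A k"
  have "?S \<longlonglongrightarrow> mexp A t"
  proof (intro vec_tendstoI)
    fix i j
    show "(\<lambda>n. ?S n $ i $ j) \<longlonglongrightarrow> mexp A t $ i $ j"
      using mexp_entry_sums[of A i j t] by (simp add: sums_def mult.commute)
  qed
  then show "(\<lambda>n. ?S n *v v) \<longlonglongrightarrow> mexp A t *v v"
    by (rule bounded_linear.tendsto[OF bounded_bilinear.bounded_linear_left[OF bounded_bilinear_matrix_vector_mult]])
  have "mpow A k *v v \<in> W" for k
    using assms by (induction k) (auto simp: mpow_mult_vector)
  moreover have "?S n *v v = (\<Sum>k<n. (t ^ k / fact k) *\<^sub>R (mpow A k *v v))" for n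
    by (simp add: bounded_bilinear.sum_left[OF bounded_bilinear_matrix_vector_mult]
        scaleR_matrix_vector_assoc)
  ultimately show "\<forall>\<^sub>F n in sequentially. ?S n *v v \<in> W"
    using assms(1) by (intro always_eventually allI) (simp add: subspace_sum subspace_scale)
qed simp

section \<open>Piecewise continuous controls\<close>

lemma PC_const: "w \<in> E \<Longrightarrow> (\<lambda>_. w) \<in> PC E"
  unfolding PC_def by auto

text \<open>
  The left piece is used at the breakpoint itself; this is what left continuity requires.
\<close>

lemma PC_glue:
  assumes u: "u \<in> PC E" and v: "v \<in> PC E"
  shows "(\<lambda>t. if t \<le> c then u t else v t) \<in> PC E"
proof -
  let ?w = "\<lambda>t. if t \<le> c then u t else v t"
  have before: "\<forall>\<^sub>F x in nhds t. ?w x = u x" if "t < c" for t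
    using eventually_nhds_in_open[of "{..<c}" t] that by (auto elim: eventually_mono)
  have after: "\<forall>\<^sub>F x in nhds t. ?w x = v x" if "c < t" for t
    using eventually_nhds_in_open[of "{c<..}" t] that by (auto elim: eventually_mono)
  have "{t. 0 < t \<and> \<not> isCont ?w t} \<subseteq>
      {t. 0 < t \<and> \<not> isCont u t} \<union> {t. 0 < t \<and> \<not> isCont v t} \<union> {c}"
  proof
    fix t assume t: "t \<in> {t. 0 < t \<and> \<not> isCont ?w t}"
    show "t \<in> {t. 0 < t \<and> \<not> isCont u t} \<union> {t. 0 < t \<and> \<not> isCont v t} \<union> {c}"
    proof (rule ccontr)
      assume "\<not> ?thesis"
      then have "isCont u t" "isCont v t" "t \<noteq> c"
        using t by auto
      then have "isCont ?w t"
        using isCont_cong[OF before] isCont_cong[OF after] by (metis linorder_neqE_linordered_idom)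
      then show False
        using t by simp
    qed
  qed
  then have "finite {t. 0 < t \<and> \<not> isCont ?w t}"
    by (rule finite_subset) (use u v in \<open>auto simp: PC_def\<close>)
  moreover have "(?w \<longlongrightarrow> ?w t) (at_left t)" if "0 < t" for t
  proof (cases "t \<le> c")
    case True
    have "\<forall>\<^sub>F x in at_left t. ?w x = u x"
      using True by (auto simp: eventually_at_filter)
    then show ?thesis
      using True u that by (auto simp: PC_def cong: tendsto_cong)
  next
    case False
    then have "\<forall>\<^sub>F x in at_left t. ?w x = v x"
      using after[of t] by (auto simp: eventually_at_filter elim: eventually_mono)
    then show ?thesis
      using False v that by (auto simp: PC_def cong: tendsto_cong)
  qed
  moreover have "\<exists>r. (?w \<longlongrightarrow> r) (at_right t)" if "0 < t" for t
  proof (cases "t < c")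
    case True
    then have "\<forall>\<^sub>F x in at_right t. ?w x = u x"
      using before[of t] by (auto simp: eventually_at_filter elim: eventually_mono)
    then show ?thesis
      using u that by (auto simp: PC_def cong: tendsto_cong)
  next
    case False
    then have "\<forall>\<^sub>F x in at_right t. ?w x = v x"
      by (auto simp: eventually_at_filter)
    then show ?thesis
      using v that by (auto simp: PC_def cong: tendsto_cong)
  qed
  moreover have "?w t \<in> E" if "0 < t" for t
    using u v that by (auto simp: PC_def)
  ultimately show ?thesis
    unfolding PC_def by blast
qed

lemma PC_convex:
  fixes E :: "'a::real_normed_vector set"
  assumes E: "convex E" and u: "u \<in> PC E" and v: "v \<in> PC E"
    and ab: "0 \<le> a" "0 \<le> b" "a + b = 1"
  shows "(\<lambda>t. a *\<^sub>R u t + b *\<^sub>R v t) \<in> PC E"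
proof -
  let ?w = "\<lambda>t. a *\<^sub>R u t + b *\<^sub>R v t"
  have "{t. 0 < t \<and> \<not> isCont ?w t} \<subseteq> {t. 0 < t \<and> \<not> isCont u t} \<union> {t. 0 < t \<and> \<not> isCont v t}"
    by (auto intro!: continuous_intros)
  then have "finite {t. 0 < t \<and> \<not> isCont ?w t}"
    by (rule finite_subset) (use u v in \<open>auto simp: PC_def\<close>)
  moreover have "?w t \<in> E" if "0 < t" for t
    using u v that ab by (auto simp: PC_def intro: convexD[OF E])
  moreover have "(?w \<longlongrightarrow> ?w t) (at_left t)" if "0 < t" for t
    using u v that by (auto simp: PC_def intro!: tendsto_intros)
  moreover have "\<exists>r. (?w \<longlongrightarrow> r) (at_right t)" if t: "0 < t" for t
  proof -
    obtain r s where "(u \<longlongrightarrow> r) (at_right t)" "(v \<longlongrightarrow> s) (at_right t)"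
      using u v t unfolding PC_def by blast
    then have "(?w \<longlongrightarrow> a *\<^sub>R r + b *\<^sub>R s) (at_right t)"
      by (intro tendsto_intros)
    then show ?thesis ..
  qed
  ultimately show ?thesis
    unfolding PC_def by blast
qed

lemma PC_norm_le_1: "u \<in> PC (cball 0 1) \<Longrightarrow> 0 < t \<Longrightarrow> norm (u t) \<le> 1"
  by (auto simp: PC_def)

text \<open>
  Boundedness is an assumption because nothing controls \<open>f\<close> near the left end point: a control need not
  have a limit at time zero.
\<close>

lemma bounded_piecewise_continuous_integrable:
  fixes f :: "real \<Rightarrow> 'a::euclidean_space"
  assumes "finite X" "continuous_on ({a<..<b} - X) f" "\<And>t. t \<in> {a<..<b} \<Longrightarrow> norm (f t) \<le> C"
  shows "f integrable_on {a..b}"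
proof -
  let ?S = "{a<..<b} - X"
  have "open ?S"
    using assms(1) by (simp add: open_Diff finite_imp_closed)
  moreover have "bounded ?S"
    by (rule bounded_subset[of "{a<..<b}"]) auto
  ultimately have S: "?S \<in> lmeasurable"
    by (intro lmeasurable_open)
  have "f integrable_on ?S"
  proof (rule measurable_bounded_by_integrable_imp_integrable)
    show "f \<in> borel_measurable (lebesgue_on ?S)"
      using assms(2) S by (intro continuous_imp_measurable_on_sets_lebesgue fmeasurableD)
    show "(\<lambda>_. C) integrable_on ?S"
      using S by (rule integrable_on_const)
    show "?S \<in> sets lebesgue"
      using S by (rule fmeasurableD)
  qed (use assms in auto)
  then show ?thesis
  proof (rule integrable_spike_set)
    show "negligible {x \<in> ?S - {a..b}. f x \<noteq> 0}"
      by (rule negligible_subset[of "{}"]) auto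
    show "negligible {x \<in> {a..b} - ?S. f x \<noteq> 0}"
      by (rule negligible_subset[of "insert a (insert b X)"])
        (use assms(1) in \<open>auto intro: negligible_finite\<close>)
  qed
qed

text \<open>
  The integrand of the variation of constants formula: a solution satisfies
  \<open>exp (- t A) x(t) = x(0) + \<integral> drive A B u\<close>, the integral being taken over \<open>[0, t]\<close>. Thus the control
  steers \<open>x0\<close> to the origin at time \<open>t\<close> exactly if this integral equals \<open>- x0\<close>.
\<close>

definition drive :: "real^'n^'n \<Rightarrow> real^'m^'n \<Rightarrow> (real \<Rightarrow> real^'m) \<Rightarrow> real \<Rightarrow> real^'n" where
  "drive A B u s = mexp A (- s) *v (B *v u s)"

lemma isCont_mexp_minus: "isCont (\<lambda>t. mexp A (- t)) t"
  using mexp_minus_deriv has_vector_derivative_continuous by blast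

lemma isCont_drive:
  assumes "isCont u t"
  shows "isCont (drive A B u) t"
  unfolding drive_def
  by (intro bounded_bilinear.isCont[OF bounded_bilinear_matrix_vector_mult] isCont_mexp_minus
      bounded_linear.isCont[OF matrix_vector_mul_bounded_linear] assms)

lemma drive_integrable:
  fixes A :: "real^'n^'n" and B :: "real^'m^'n"
  assumes u: "u \<in> PC (cball 0 1)" and "0 \<le> a"
  shows "drive A B u integrable_on {a..b}"
proof -
  have "compact ((\<lambda>t. mexp A (- t)) ` {a..b})"
    by (intro compact_continuous_image continuous_at_imp_continuous_on ballI isCont_mexp_minus) auto
  then obtain K where K: "\<And>t. t \<in> {a..b} \<Longrightarrow> norm (mexp A (- t)) \<le> K"
    using compact_imp_bounded bounded_iff by (metis imageI)
  obtain C where C: "C \<ge> 0" "\<And>x y. norm ((x :: real^'n^'n) *v y) \<le> norm x * norm y * C"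
    using bounded_bilinear.nonneg_bounded[OF bounded_bilinear_matrix_vector_mult] by blast
  obtain D where D: "\<And>w. norm (B *v w) \<le> norm w * D" "D > 0"
    using bounded_linear.pos_bounded[OF matrix_vector_mul_bounded_linear[of B]] by blast
  have bd: "norm (drive A B u t) \<le> K * D * C" if "t \<in> {a<..<b}" for t
  proof -
    have t: "t \<in> {a..b}" "0 < t"
      using that assms(2) by auto
    have "norm (B *v u t) \<le> 1 * D"
      using D(1)[of "u t"] mult_right_mono[OF PC_norm_le_1[OF u t(2)], of D] D(2) by linarith
    then have "norm (mexp A (- t)) * norm (B *v u t) \<le> K * D"
      using K[OF t(1)] by (intro mult_mono) (auto intro: order_trans[OF norm_ge_zero])
    then have "norm (mexp A (- t)) * norm (B *v u t) * C \<le> K * D * C"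
      using C(1) by (rule mult_right_mono)
    then show ?thesis
      using C(2)[of "mexp A (- t)" "B *v u t"] unfolding drive_def by linarith
  qed
  show ?thesis
  proof (rule bounded_piecewise_continuous_integrable[OF _ _ bd])
    show "finite {t. 0 < t \<and> \<not> isCont u t}"
      using u by (simp add: PC_def)
    show "continuous_on ({a<..<b} - {t. 0 < t \<and> \<not> isCont u t}) (drive A B u)"
      using assms(2) by (intro continuous_at_imp_continuous_on ballI isCont_drive) auto
  qed
qed

text \<open>
  The derivative of \<open>exp (- t A) x(t)\<close> is the drive, outside the finitely many discontinuities of \<open>u\<close>.
\<close>

lemma solution_drive_integral:
  assumes x: "is_solution A B x0 u x" and u: "u \<in> PC E" and "0 \<le> t"
  shows "(drive A B u has_integral (mexp A (- t) *v x t - x0)) {0..t}"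
proof -
  have "(drive A B u has_integral (mexp A (- t) *v x t - mexp A (- 0) *v x 0)) {0..t}"
  proof (rule fundamental_theorem_of_calculus_interior_strong)
    show "finite {t. 0 < t \<and> \<not> isCont u t}"
      using u by (simp add: PC_def)
    show "continuous_on {0..t} (\<lambda>t. mexp A (- t) *v x t)"
    proof (intro bounded_bilinear.continuous_on[OF bounded_bilinear_matrix_vector_mult])
      show "continuous_on {0..t} (\<lambda>t. mexp A (- t))"
        by (intro continuous_at_imp_continuous_on ballI isCont_mexp_minus)
      show "continuous_on {0..t} x"
        using x by (auto simp: is_solution_def intro: continuous_on_subset)
    qed
    fix s assume "s \<in> {0<..<t} - {t. 0 < t \<and> \<not> isCont u t}"
    then have "(x has_vector_derivative (A *v x s + B *v u s)) (at s)"
      using x by (auto simp: is_solution_def)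
    from bounded_bilinear.has_vector_derivative[OF bounded_bilinear_matrix_vector_mult
        mexp_minus_deriv this, of A]
    show "((\<lambda>t. mexp A (- t) *v x t) has_vector_derivative drive A B u s) (at s)"
      by (simp add: drive_def matrix_vector_right_distrib matrix_vector_mul_assoc
          bounded_bilinear.minus_left[OF bounded_bilinear_matrix_vector_mult])
  qed fact
  then show ?thesis
    using x by (simp add: is_solution_def)
qed

lemma steers_to_zeroI:
  assumes u: "u \<in> PC (cball 0 1)" and "0 < t"
    and int: "integral {0..t} (drive A B u) = - x0"
  shows "steers_to_zero A B x0 u t"
proof -
  define y where "y \<tau> = x0 + integral {0..\<tau>} (drive A B u)" for \<tau>
  define x where "x \<tau> = mexp A \<tau> *v y \<tau>" for \<tau>
  have mexp_cont: "isCont (mexp A) \<tau>" for \<tau>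
    using mexp_deriv has_vector_derivative_continuous by blast
  have "is_solution A B x0 u x"
    unfolding is_solution_def
  proof (intro conjI allI impI)
    have "continuous (at \<tau> within {0..}) y" if "\<tau> \<in> {0..}" for \<tau>
    proof -
      have "continuous_on {0..\<tau> + 1} y"
        unfolding y_def
        by (intro continuous_intros indefinite_integral_continuous_1 drive_integrable u) simp
      then have "continuous (at \<tau> within {0..\<tau> + 1}) y"
        using that by (simp add: continuous_on_eq_continuous_within)
      moreover have "at \<tau> within {0..\<tau> + 1} = at \<tau> within {0..}"
        by (rule at_within_nhd[of _ "{..<\<tau> + 1}"]) auto
      ultimately show ?thesis by simp
    qed
    then have "continuous_on {0..} y"
      by (simp add: continuous_on_eq_continuous_within)
    then show "continuous_on {0..} x"
      unfolding x_def
      by (rule bounded_bilinear.continuous_on[OF bounded_bilinear_matrix_vector_mult, rotated])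
        (intro continuous_at_imp_continuous_on ballI mexp_cont)
    show "x 0 = x0"
      by (simp add: x_def y_def)
    fix s :: real assume s: "0 < s" "isCont u s"
    have "((\<lambda>\<tau>. integral {0..\<tau>} (drive A B u)) has_vector_derivative drive A B u s)
        (at s within ({0..s + 1} - {}))"
    proof (rule integral_has_vector_derivative_continuous_at)
      show "drive A B u integrable_on {0..s + 1}"
        by (intro drive_integrable u) simp
      show "continuous (at s within ({0..s + 1} - {})) (drive A B u)"
        by (rule continuous_at_imp_continuous_at_within[OF isCont_drive[OF s(2)]])
    qed (use s in auto)
    then have "((\<lambda>\<tau>. integral {0..\<tau>} (drive A B u)) has_vector_derivative drive A B u s) (at s)"
      using s at_within_Icc_at[of 0 s "s + 1"] by simp
    then have "(y has_vector_derivative drive A B u s) (at s)"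
      unfolding y_def by (auto intro!: derivative_eq_intros)
    from bounded_bilinear.has_vector_derivative[OF bounded_bilinear_matrix_vector_mult
        mexp_deriv this, of A]
    have "(x has_vector_derivative (mexp A s *v drive A B u s + (A ** mexp A s) *v y s)) (at s)"
      unfolding x_def .
    moreover have "mexp A s *v drive A B u s = B *v u s"
      using matrix_vector_mul_assoc[of "mexp A s" "mexp A (- s)" "B *v u s"]
      by (simp add: drive_def mexp_inverse)
    moreover have "(A ** mexp A s) *v y s = A *v x s"
      by (simp add: x_def matrix_vector_mul_assoc)
    ultimately have "(x has_vector_derivative B *v u s + A *v x s) (at s)"
      by (simp only:)
    then show "(x has_vector_derivative A *v x s + B *v u s) (at s)"
      by (simp only: add.commute)
  qed
  moreover have "x t = 0"
    by (simp add: x_def y_def int)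
  ultimately show ?thesis
    unfolding steers_to_zero_def by blast
qed

section \<open>The maximum principle\<close>

text \<open>
  The function \<open>B\<^sup>T exp (- s A\<^sup>T) \<eta>\<close> of the maximum principle.
\<close>

definition switching_function ::
  "real^'n^'n \<Rightarrow> real^'m^'n \<Rightarrow> real^'n \<Rightarrow> real \<Rightarrow> real^'m" where
  "switching_function A B \<eta> s = \<eta> v* (mexp A (- s) ** B)"

lemma inner_drive: "\<eta> \<bullet> drive A B u s = switching_function A B \<eta> s \<bullet> u s"
  by (simp add: drive_def switching_function_def dot_lmul_matrix matrix_vector_mul_assoc)

lemma switching_function_nth:
  fixes A :: "real^'a^'a" and B :: "real^'b^'a"
  shows "switching_function A B \<eta> s $ j = \<eta> \<bullet> (mexp A (- s) *v column j B)"
proof -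
  have "(\<eta> v* N) $ j = \<eta> \<bullet> column j N" for N :: "real^'b^'a"
    by (simp add: vector_matrix_mult_def inner_vec_def column_def mult.commute)
  moreover have "column j (M ** B) = M *v column j B" for M :: "real^'a^'a"
    by (simp add: vec_eq_iff column_def matrix_matrix_mult_def matrix_vector_mult_def)
  ultimately show ?thesis
    by (simp add: switching_function_def)
qed

lemma isCont_switching_function: "isCont (switching_function A B \<eta>) s"
proof -
  have "bounded_linear (\<lambda>M. \<eta> v* (M ** B))"
    by (intro linear_conv_bounded_linear[THEN iffD1] linearI)
      (simp_all add: vec_eq_iff vector_matrix_mult_def matrix_matrix_mult_def sum.distrib
        sum_distrib_left sum_distrib_right algebra_simps)
  then show ?thesis
    unfolding switching_function_def using isCont_mexp_minus by (rule bounded_linear.isCont)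
qed

definition controllable_space :: "real^'n^'n \<Rightarrow> real^'m^'n \<Rightarrow> (real^'n) set" where
  "controllable_space A B = span {(((*v) A) ^^ k) (column j B) | k j. True}"

lemma controllable_space_invariant:
  assumes "w \<in> controllable_space A B"
  shows "A *v w \<in> controllable_space A B"
  using assms unfolding controllable_space_def
proof (induction rule: span_induct_alt)
  case base
  then show ?case by (simp add: span_zero)
next
  case (step c x y)
  then obtain k j where "x = (((*v) A) ^^ k) (column j B)"
    by blast
  then have "A *v x = (((*v) A) ^^ Suc k) (column j B)"
    by simp
  then have "A *v x \<in> span {(((*v) A) ^^ k) (column j B) | k j. True}"
    by (intro span_base) blast
  then show ?case
    using step by (simp add: matrix_vector_right_distrib matrix_vector_mult_scaleR span_add span_scale)
qed

lemma mexp_controllable_space: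
  assumes "w \<in> controllable_space A B"
  shows "mexp A t *v w \<in> controllable_space A B"
proof (rule mexp_invariant_subspace[OF _ controllable_space_invariant assms])
  show "subspace (controllable_space A B)"
    by (simp add: controllable_space_def)
qed

lemma drive_in_controllable_space: "drive A B u s \<in> controllable_space A B"
proof -
  have "column j B \<in> controllable_space A B" for j
    unfolding controllable_space_def by (intro span_base) (metis (mono_tags, lifting) funpow_0 mem_Collect_eq)
  moreover have "B *v u s = (\<Sum>j\<in>UNIV. (u s $ j) *\<^sub>R column j B)"
    by (simp add: vec_eq_iff matrix_vector_mult_def column_def mult.commute)
  ultimately have "B *v u s \<in> controllable_space A B"
    unfolding controllable_space_def by (simp add: span_sum span_scale)
  then show ?thesis
    unfolding drive_def by (rule mexp_controllable_space)
qed

text \<open>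
  Consider the controls that are switched off at some time before the optimal time \<open>T\<close>. Their drive
  integrals form a convex set: the later of two switch-off times serves for every convex combination
  of the two controls. The integral \<open>- x0\<close> produced by the optimal control is not in it, since otherwise \<open>x0\<close>
  would be steered to the origin earlier. So a hyperplane with normal \<open>\<eta>\<close> separates them.

  Without controllability a normal vector could be orthogonal to everything that the controls can
  achieve. The separation theorem gives \<open>\<eta>\<close> in the span of the differences that are separated from zero;
  these lie in the controllable space, so \<open>\<eta>\<close> cannot be orthogonal to that space.
\<close>

lemma time_optimal_separation:
  fixes A :: "real^'n^'n" and B :: "real^'m^'n"
  assumes opt: "optimal_control A B x0 u" and T: "0 < optimal_time A B x0"
  obtains \<eta> where "\<exists>w\<in>controllable_space A B. \<eta> \<bullet> w \<noteq> 0"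
    "\<And>v t. v \<in> PC (cball 0 1) \<Longrightarrow> 0 < t \<Longrightarrow> t < optimal_time A B x0 \<Longrightarrow> (\<And>s. t < s \<Longrightarrow> v s = 0) \<Longrightarrow>
      \<eta> \<bullet> integral {0..optimal_time A B x0} (drive A B v)
        \<le> \<eta> \<bullet> integral {0..optimal_time A B x0} (drive A B u)"
proof -
  define T where "T = optimal_time A B x0"
  have T0: "0 < T"
    using assms by (simp add: T_def)
  have u: "u \<in> PC (cball 0 1)"
    using opt by (simp add: optimal_control_def)
  define I where "I v = integral {0..T} (drive A B v)" for v
  have int: "drive A B v integrable_on {0..T}" if "v \<in> PC (cball 0 1)" for v
    by (intro drive_integrable that) simp
  obtain x where x: "is_solution A B x0 u x" "x T = 0"
    using opt unfolding optimal_control_def steers_to_zero_def T_def by blast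
  have Iu: "I u = - x0"
    using integral_unique[OF solution_drive_integral[OF x(1) u, of T]] x(2) T0 by (simp add: I_def)
  \<comment> \<open>The controls that are switched off before the optimal time.\<close>
  define early :: "(real \<Rightarrow> real^'m) set" where
    "early = {v \<in> PC (cball 0 1). \<exists>t. 0 < t \<and> t < T \<and> (\<forall>s>t. v s = 0)}"
  have "convex (I ` early)"
  proof (rule convexI)
    fix y z and a b :: real
    assume "y \<in> I ` early" "z \<in> I ` early" and ab: "0 \<le> a" "0 \<le> b" "a + b = 1"
    then obtain v w where v: "v \<in> early" "y = I v" and w: "w \<in> early" "z = I w"
      by blast
    obtain r where r: "0 < r" "r < T" "\<forall>s>r. v s = 0"
      using v by (auto simp: early_def)
    obtain r' where r': "0 < r'" "r' < T" "\<forall>s>r'. w s = 0"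
      using w by (auto simp: early_def)
    let ?c = "\<lambda>t. a *\<^sub>R v t + b *\<^sub>R w t"
    have "?c \<in> PC (cball 0 1)"
      using v w ab by (intro PC_convex) (auto simp: early_def)
    then have c: "?c \<in> early"
      using r r' unfolding early_def by (auto intro!: exI[of _ "max r r'"])
    have "drive A B ?c = (\<lambda>s. a *\<^sub>R drive A B v s + b *\<^sub>R drive A B w s)"
      by (simp add: fun_eq_iff drive_def matrix_vector_right_distrib matrix_vector_mult_scaleR)
    then have "I ?c = a *\<^sub>R y + b *\<^sub>R z"
      using int v w unfolding I_def early_def
      by (simp add: integral_add integral_cmul integrable_cmul)
    then show "a *\<^sub>R y + b *\<^sub>R z \<in> I ` early"
      using imageI[OF c, of I] by simp
  qed
  then have conv: "convex ((\<lambda>y. I u - y) ` I ` early)"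
    using convex_affinity[of "I ` early" "I u" "- 1"] by simp
  have "(\<lambda>_. 0) \<in> early"
    using T0 PC_const[of 0 "cball 0 1"] by (auto simp: early_def intro!: exI[of _ "T / 2"])
  then have ne: "(\<lambda>y. I u - y) ` I ` early \<noteq> {}"
    by blast
  have "I u \<notin> I ` early"
  proof
    assume "I u \<in> I ` early"
    then obtain v t where v: "v \<in> PC (cball 0 1)" "I v = - x0"
      and t: "0 < t" "t < T" "\<And>s. t < s \<Longrightarrow> v s = 0"
      using Iu by (force simp: early_def)
    have "(drive A B v has_integral 0) {t..T}"
      by (rule has_integral_spike_finite[of "{t}" _ _ "\<lambda>_. 0"]) (use t in \<open>auto simp: drive_def\<close>)
    then have "integral {0..t} (drive A B v) = - x0"
      using Henstock_Kurzweil_Integration.integral_combine[of 0 t T "drive A B v"] t v int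
      by (simp add: I_def integral_unique)
    then have "steers_to_zero A B x0 v t"
      by (intro steers_to_zeroI v t)
    then have "optimal_time A B x0 \<le> t"
      unfolding optimal_time_def using v(1) t(1)
      by (intro cInf_lower bdd_belowI[of _ 0]) auto
    then show False
      using t(2) by (simp add: T_def)
  qed
  then have "0 \<notin> (\<lambda>y. I u - y) ` I ` early"
    by auto
  from separating_hyperplane_set_0_inspan[OF conv ne this]
  obtain \<eta> where \<eta>: "\<eta> \<in> span ((\<lambda>y. I u - y) ` I ` early)" "\<eta> \<noteq> 0"
    "\<And>y. y \<in> (\<lambda>y. I u - y) ` I ` early \<Longrightarrow> 0 \<le> \<eta> \<bullet> y"
    by blast
  show thesis
  proof (rule that)
    show "\<exists>w\<in>controllable_space A B. \<eta> \<bullet> w \<noteq> 0"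
    proof (rule ccontr)
      assume *: "\<not> ?thesis"
      have perp: "\<eta> \<bullet> I v = 0" if "v \<in> PC (cball 0 1)" for v
      proof -
        have "((\<lambda>s. \<eta> \<bullet> drive A B v s) has_integral \<eta> \<bullet> I v) {0..T}"
          unfolding I_def
          using has_integral_linear[OF integrable_integral[OF int[OF that]] bounded_linear_inner_right]
          by (simp add: o_def)
        moreover have "\<eta> \<bullet> drive A B v s = 0" for s
          using * drive_in_controllable_space by blast
        ultimately show ?thesis
          by (simp add: has_integral_0_eq)
      qed
      then have "orthogonal \<eta> y" if "y \<in> (\<lambda>y. I u - y) ` I ` early" for y
        using that u by (auto simp: orthogonal_def inner_diff_right early_def)
      then have "orthogonal \<eta> \<eta>"
        using \<eta>(1) orthogonal_to_span by blast
      then show False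
        using \<eta>(2) by (simp add: orthogonal_self)
    qed
    fix v :: "real \<Rightarrow> real^'m" and t
    assume "v \<in> PC (cball 0 1)" "0 < t" "t < optimal_time A B x0" "\<And>s. t < s \<Longrightarrow> v s = 0"
    then have "v \<in> early"
      by (auto simp: early_def T_def)
    then have "0 \<le> \<eta> \<bullet> (I u - I v)"
      by (intro \<eta>) blast
    then show "\<eta> \<bullet> integral {0..optimal_time A B x0} (drive A B v)
        \<le> \<eta> \<bullet> integral {0..optimal_time A B x0} (drive A B u)"
      by (simp add: I_def T_def inner_diff_right)
  qed
qed

lemma integral_le_const_interior:
  fixes f :: "real \<Rightarrow> real"
  assumes "f integrable_on {a..b}" "a \<le> b" "\<And>x. x \<in> {a<..<b} \<Longrightarrow> f x \<le> c"
  shows "integral {a..b} f \<le> c * (b - a)"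
proof -
  have "integral {a<..<b} f \<le> integral {a<..<b} (\<lambda>_. c)"
    using assms by (intro integral_le) (auto simp: integrable_on_Icc_iff_Ioo[symmetric])
  then show ?thesis
    using assms(2) by (simp add: integral_open_interval_real[symmetric] mult.commute)
qed

text \<open>
  A needle variation: if \<open>p \<bullet> u < p \<bullet> w\<close> at some time \<open>\<tau>\<close>, where \<open>p\<close> is the switching function, then, by left
  continuity, replacing \<open>u\<close> by \<open>w\<close> on a short interval that ends at \<open>\<tau>\<close> increases the integral of \<open>p \<bullet> u\<close> by a
  fixed amount. Switching the control off on a much shorter interval before the optimal time costs less
  than that, which contradicts the separation inequality. So \<open>u\<close> maximises \<open>p \<bullet> w\<close> over the unit ball at
  each time, and the maximiser is unique where \<open>p\<close> does not vanish. Left continuity makes this hold at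
  every time, not merely at almost every time.
\<close>

theorem maximum_principle:
  fixes A :: "real^'n^'n" and B :: "real^'m^'n"
  assumes opt: "optimal_control A B x0 u" and T: "0 < optimal_time A B x0"
  obtains \<eta> where "\<exists>w\<in>controllable_space A B. \<eta> \<bullet> w \<noteq> 0"
    "\<And>s. s \<in> {0<..<optimal_time A B x0} \<Longrightarrow> switching_function A B \<eta> s \<noteq> 0 \<Longrightarrow>
      u s = sgn (switching_function A B \<eta> s)"
proof -
  define T where "T = optimal_time A B x0"
  obtain \<eta> where \<eta>: "\<exists>w\<in>controllable_space A B. \<eta> \<bullet> w \<noteq> 0"
    "\<And>v t. v \<in> PC (cball 0 1) \<Longrightarrow> 0 < t \<Longrightarrow> t < T \<Longrightarrow> (\<And>s. t < s \<Longrightarrow> v s = 0) \<Longrightarrow>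
      \<eta> \<bullet> integral {0..T} (drive A B v) \<le> \<eta> \<bullet> integral {0..T} (drive A B u)"
    unfolding T_def by (rule time_optimal_separation[OF opt T]) blast
  let ?p = "switching_function A B \<eta>"
  have u: "u \<in> PC (cball 0 1)"
    using opt by (simp add: optimal_control_def)
  have int: "(\<lambda>s. ?p s \<bullet> v s) integrable_on {a..b}" if "v \<in> PC (cball 0 1)" "0 \<le> a" for v a b
    using integrable_linear[OF drive_integrable[OF that, where A = A and B = B and b = b] bounded_linear_inner_right[of \<eta>]]
    by (simp add: o_def inner_drive)
  have eint: "\<eta> \<bullet> integral {0..T} (drive A B v) = integral {0..T} (\<lambda>s. ?p s \<bullet> v s)"
    if "v \<in> PC (cball 0 1)" for v
    using integral_linear[OF drive_integrable[OF that order_refl, where A = A and B = B and b = T] bounded_linear_inner_right[of \<eta>]]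
    by (simp add: o_def inner_drive)
  have "compact (?p ` {0..T})"
    by (intro compact_continuous_image continuous_at_imp_continuous_on ballI
        isCont_switching_function) auto
  then obtain C where C: "\<And>s. s \<in> {0..T} \<Longrightarrow> norm (?p s) \<le> C"
    using compact_imp_bounded bounded_iff by (metis imageI)
  have pointwise: "?p \<tau> \<bullet> w \<le> ?p \<tau> \<bullet> u \<tau>" if \<tau>: "\<tau> \<in> {0<..<T}" and w: "w \<in> cball 0 1" for \<tau> w
  proof (rule ccontr)
    assume contra: "\<not> ?thesis"
    define g where "g s = ?p s \<bullet> (u s - w)" for s
    define \<epsilon> where "\<epsilon> = - g \<tau> / 2"
    have \<epsilon>: "\<epsilon> > 0"
      using contra by (simp add: \<epsilon>_def g_def inner_diff_right)
    have "(?p \<longlongrightarrow> ?p \<tau>) (at_left \<tau>)"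
      using isCont_switching_function[where A = A and B = B and \<eta> = \<eta> and s = \<tau>]
      by (simp add: isCont_def filterlim_at_split)
    moreover have "(u \<longlongrightarrow> u \<tau>) (at_left \<tau>)"
      using u \<tau> by (simp add: PC_def)
    ultimately have "(g \<longlongrightarrow> g \<tau>) (at_left \<tau>)"
      unfolding g_def by (intro tendsto_intros)
    then have "\<forall>\<^sub>F s in at_left \<tau>. g s < - \<epsilon>"
      by (rule order_tendstoD) (use \<epsilon> in \<open>simp add: \<epsilon>_def\<close>)
    then have "\<exists>b<\<tau>. \<forall>s>b. s < \<tau> \<longrightarrow> g s < - \<epsilon>"
      by (simp only: eventually_at_left_field)
    then obtain b where b: "b < \<tau>" "\<And>s. b < s \<Longrightarrow> s < \<tau> \<Longrightarrow> g s < - \<epsilon>"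
      by blast
    \<comment> \<open>The needle occupies the interval from \<open>a\<close> to \<open>\<tau>\<close>; it must begin after time zero.\<close>
    define a where "a = max b (\<tau> / 2)"
    have a: "0 < a" "a < \<tau>" "\<And>s. a < s \<Longrightarrow> s < \<tau> \<Longrightarrow> g s < - \<epsilon>"
      using b \<tau> by (auto simp: a_def)
    define D where "D = \<bar>C\<bar> + 1"
    \<comment> \<open>The needle gains at least \<open>\<epsilon> (\<tau> - a)\<close>; switching off for a time \<open>\<delta>\<close> costs at most \<open>D \<delta>\<close>.\<close>
    define \<delta> where "\<delta> = min ((T - \<tau>) / 2) (\<epsilon> * (\<tau> - a) / (2 * D))"
    have D: "D > 0" "\<And>s. s \<in> {0..T} \<Longrightarrow> norm (?p s) \<le> D"
      using C by (force simp: D_def)+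
    have \<delta>: "0 < \<delta>" "\<delta> < T - \<tau>" "D * \<delta> < \<epsilon> * (\<tau> - a)"
    proof -
      show "0 < \<delta>"
        using \<epsilon> D(1) a \<tau> by (simp add: \<delta>_def)
      show "\<delta> < T - \<tau>"
        using \<tau> by (simp add: \<delta>_def min_def)
      have "D * \<delta> \<le> D * (\<epsilon> * (\<tau> - a) / (2 * D))"
        using D(1) by (intro mult_left_mono) (simp_all add: \<delta>_def)
      also have "\<dots> = \<epsilon> * (\<tau> - a) / 2"
        using D(1) by simp
      also have "\<dots> < \<epsilon> * (\<tau> - a)"
        using \<epsilon> a(2) by simp
      finally show "D * \<delta> < \<epsilon> * (\<tau> - a)" .
    qed
    define t where "t = T - \<delta>"
    have t: "\<tau> < t" "t < T" "T - t = \<delta>"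
      using \<delta> by (auto simp: t_def)
    define v where "v s = (if s \<le> a then u s else if s \<le> \<tau> then w else if s \<le> t then u s else 0)" for s
    have v: "v \<in> PC (cball 0 1)"
      unfolding v_def by (intro PC_glue PC_const u w) simp
    define k where "k s = ?p s \<bullet> u s - ?p s \<bullet> v s" for s
    have kint: "k integrable_on {c..d}" if "0 \<le> c" for c d
      unfolding k_def by (intro integrable_diff int u v that)
    have "0 \<le> \<eta> \<bullet> integral {0..T} (drive A B u) - \<eta> \<bullet> integral {0..T} (drive A B v)"
      using \<eta>(2)[OF v, of t] t a by (simp add: v_def)
    also have "\<dots> = integral {0..T} k"
      unfolding k_def using eint int u v by (simp add: integral_diff)
    also have "\<dots> = integral {0..a} k + integral {a..\<tau>} k + integral {\<tau>..t} k + integral {t..T} k"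
    proof -
      note comb = Henstock_Kurzweil_Integration.integral_combine
      show ?thesis
        using comb[of 0 a T k] comb[of a \<tau> T k] comb[of \<tau> t T k] kint a t \<tau> by auto
    qed
    also have "\<dots> \<le> 0 + - \<epsilon> * (\<tau> - a) + 0 + D * \<delta>"
    proof (intro add_mono)
      show "integral {0..a} k \<le> 0"
        using integral_le_const_interior[OF kint, of 0 a 0] a by (simp add: k_def v_def)
      show "integral {a..\<tau>} k \<le> - \<epsilon> * (\<tau> - a)"
      proof (rule integral_le_const_interior[OF kint])
        fix s assume "s \<in> {a<..<\<tau>}"
        then show "k s \<le> - \<epsilon>"
          using a(3)[of s] by (simp add: k_def v_def g_def inner_diff_right)
      qed (use a in auto)
      show "integral {\<tau>..t} k \<le> 0"
        using integral_le_const_interior[OF kint, of \<tau> t 0] a t by (simp add: k_def v_def)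
      have "integral {t..T} k \<le> D * (T - t)"
      proof (rule integral_le_const_interior[OF kint])
        fix s assume s: "s \<in> {t<..<T}"
        then have "s \<in> {0..T}" "0 < s"
          using a t by auto
        have "?p s \<bullet> u s \<le> norm (?p s) * norm (u s)"
          by (rule norm_cauchy_schwarz)
        also have "\<dots> \<le> D * 1"
          using D(1) D(2)[OF \<open>s \<in> {0..T}\<close>] PC_norm_le_1[OF u \<open>0 < s\<close>] by (intro mult_mono) auto
        finally show "k s \<le> D"
          using s t a by (simp add: k_def v_def)
      qed (use a t in auto)
      then show "integral {t..T} k \<le> D * \<delta>"
        using t(3) by simp
    qed
    finally show False
      using \<delta>(3) by simp
  qed
  show thesis
  proof (rule that[OF \<eta>(1)])
    fix s assume s: "s \<in> {0<..<optimal_time A B x0}" and p0: "?p s \<noteq> 0"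
    then have "?p s \<bullet> sgn (?p s) \<le> ?p s \<bullet> u s"
      by (intro pointwise) (auto simp: T_def norm_sgn)
    moreover have "?p s \<bullet> sgn (?p s) = norm (?p s)"
      using p0 by (simp add: sgn_div_norm power2_norm_eq_inner[symmetric] power2_eq_square)
    ultimately have "norm (?p s) \<le> ?p s \<bullet> u s"
      by simp
    moreover have "sgn (?p s) \<bullet> u s = ?p s \<bullet> u s / norm (?p s)"
      by (simp add: sgn_div_norm divide_inverse mult.commute)
    ultimately have "1 \<le> sgn (?p s) \<bullet> u s"
      using p0 by (simp add: le_divide_eq_1_pos)
    moreover have "(norm (u s))\<^sup>2 \<le> 1"
      using PC_norm_le_1[OF u, of s] s by (simp add: power_le_one)
    moreover have "(norm (u s - sgn (?p s)))\<^sup>2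
        = (norm (u s))\<^sup>2 - 2 * (sgn (?p s) \<bullet> u s) + (norm (sgn (?p s)))\<^sup>2"
      by (simp add: power2_norm_eq_inner inner_diff_left inner_diff_right inner_commute)
    ultimately have "(norm (u s - sgn (?p s)))\<^sup>2 \<le> 0"
      using p0 by (simp add: norm_sgn)
    then show "u s = sgn (?p s)"
      by simp
  qed
qed

section \<open>Switching points\<close>

lemma observed_flow_mexp:
  fixes A :: "real^'n^'n"
  shows "observed_flow ((*v) A) (\<lambda>v t. \<eta> \<bullet> (mexp A (- t) *v v))"
proof (rule observed_flow.intro)
  show "linear ((*v) A)"
    by (rule linear_matrix_action)
  show "linear (\<lambda>v. \<eta> \<bullet> (mexp A (- t) *v v))" for t
    by (intro linearI)
      (simp_all add: matrix_vector_right_distrib matrix_vector_mult_scaleR inner_add_right)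
  fix v :: "real^'n" and t :: real
  have "bounded_linear (\<lambda>M. \<eta> \<bullet> (M *v v))"
    by (intro bounded_linear_compose[OF bounded_linear_inner_right]
        bounded_bilinear.bounded_linear_left[OF bounded_bilinear_matrix_vector_mult])
  from bounded_linear.has_vector_derivative[OF this mexp_minus_deriv]
  show "((\<lambda>t. \<eta> \<bullet> (mexp A (- t) *v v)) has_real_derivative - (\<eta> \<bullet> (mexp A (- t) *v (A *v v)))) (at t)"
    by (simp add: has_real_derivative_iff_has_vector_derivative matrix_vector_mul_assoc
        bounded_bilinear.minus_left[OF bounded_bilinear_matrix_vector_mult])
qed

text \<open>
  The vectors annihilated by \<open>\<eta> \<bullet> exp (- s A)\<close> cannot include the whole controllable space, because
  that space is mapped onto itself by \<open>exp (- s A)\<close>. Since the numbers in question are, up to sign, the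
  derivatives at \<open>s\<close> of the components of the switching function, the switching function has a zero of
  finite order at worst.
\<close>

lemma observable_at_every_time:
  assumes "\<exists>w\<in>controllable_space A B. \<eta> \<bullet> w \<noteq> 0"
  obtains k j where "\<eta> \<bullet> (mexp A (- s) *v ((((*v) A) ^^ k) (column j B))) \<noteq> 0"
proof (rule ccontr)
  assume "\<not> thesis"
  then have *: "\<eta> \<bullet> (mexp A (- s) *v ((((*v) A) ^^ k) (column j B))) = 0" for k j
    using that by blast
  have perp: "\<eta> \<bullet> (mexp A (- s) *v w) = 0" if "w \<in> controllable_space A B" for w
    using that unfolding controllable_space_def
  proof (induction rule: span_induct_alt)
    case base
    then show ?case by simp
  next
    case (step c x y)
    then show ?case
      using * by (auto simp: matrix_vector_right_distrib matrix_vector_mult_scaleR inner_add_right)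
  qed
  obtain w where w: "w \<in> controllable_space A B" "\<eta> \<bullet> w \<noteq> 0"
    using assms by blast
  have "mexp A (- s) *v (mexp A s *v w) = w"
    using mexp_inverse[of A "- s"] by (simp add: matrix_vector_mul_assoc)
  then show False
    using perp[OF mexp_controllable_space[OF w(1), of s]] w(2) by simp
qed

text \<open>
  Let \<open>k\<close> be the order of the switching function \<open>p\<close> at \<open>s\<close>, with \<open>k = 0\<close> if \<open>p s \<noteq> 0\<close>. Then
  \<open>p t = (t - s) ^ k \<psi> t\<close> near \<open>s\<close>, where \<open>\<psi>\<close> has a limit \<open>c \<noteq> 0\<close>, and the control \<open>sgn (p t)\<close> has the one-sided
  limits \<open>(- 1) ^ k sgn c\<close> and \<open>sgn c\<close>. For even \<open>k\<close> they agree and the control is continuous. So at a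
  switching point \<open>k\<close> is odd, whence both assertions.
\<close>

lemma switching_structure:
  fixes A :: "real^'n^'n" and B :: "real^'m^'n"
  assumes u: "u \<in> PC E"
    and ctrl: "\<exists>w\<in>controllable_space A B. \<eta> \<bullet> w \<noteq> 0"
    and bang: "\<And>s. s \<in> {0<..<T} \<Longrightarrow> switching_function A B \<eta> s \<noteq> 0 \<Longrightarrow>
      u s = sgn (switching_function A B \<eta> s)"
    and s: "s \<in> switching_points T u"
  shows "switching_function A B \<eta> s = 0"
    and "\<exists>l r. (u \<longlongrightarrow> l) (at_left s) \<and> (u \<longlongrightarrow> r) (at_right s) \<and> l + r = 0"
proof -
  let ?p = "switching_function A B \<eta>"
  define F where "F v t = \<eta> \<bullet> (mexp A (- t) *v v)" for v t
  interpret observed_flow "(*v) A" F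
    unfolding F_def by (rule observed_flow_mexp)
  have pF: "?p t $ j = F (column j B) t" for t j
    by (simp add: switching_function_nth F_def)
  have s0: "0 < s" "s < T" "\<not> isCont u s"
    using s by (auto simp: switching_points_def)
  \<comment> \<open>Some component of the switching function has a nonzero \<open>k\<close>-th derivative at \<open>s\<close>.\<close>
  define hit where "hit k \<longleftrightarrow> (\<exists>j. F ((((*v) A) ^^ k) (column j B)) s \<noteq> 0)" for k
  obtain k0 where k0: "hit k0"
    using observable_at_every_time[OF ctrl, of s] unfolding hit_def F_def by metis
  define k where "k = (LEAST k. hit k)"
  have k: "hit k"
    unfolding k_def using k0 by (rule LeastI)
  have below: "F ((((*v) A) ^^ i) (column j B)) s = 0" if "i < k" for i j
    using that not_less_Least unfolding k_def hit_def by blast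
  define c :: "real^'m" where
    "c = (\<chi> j. (- 1) ^ k * F ((((*v) A) ^^ k) (column j B)) s / fact k)"
  have c0: "c \<noteq> 0"
    using k by (auto simp: hit_def c_def vec_eq_iff)
  define \<psi> where "\<psi> t = (1 / (t - s) ^ k) *\<^sub>R ?p t" for t
  have \<psi>: "(\<psi> \<longlongrightarrow> c) (at s)"
  proof (rule vec_tendstoI)
    fix j
    show "((\<lambda>t. \<psi> t $ j) \<longlongrightarrow> c $ j) (at s)"
      using tendsto_power_quotient[of k "column j B" s] below by (simp add: \<psi>_def pF c_def)
  qed
  have "\<forall>\<^sub>F t in at s. \<psi> t \<noteq> 0"
    using \<psi> c0 by (rule tendsto_imp_eventually_ne)
  moreover have "\<forall>\<^sub>F t in at s. t \<in> {0<..<T}"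
    using s0 by (intro eventually_at_in_open') auto
  moreover have "\<forall>\<^sub>F t in at s. t \<noteq> s"
    by (rule eventually_neq_at_within)
  ultimately have near: "\<forall>\<^sub>F t in at s. u t = sgn (t - s) ^ k *\<^sub>R sgn (\<psi> t)"
  proof eventually_elim
    case (elim t)
    then have p: "?p t = (t - s) ^ k *\<^sub>R \<psi> t" "?p t \<noteq> 0"
      by (auto simp: \<psi>_def)
    have "u t = sgn (?p t)"
      using bang elim(2) p(2) .
    also have "\<dots> = sgn (t - s) ^ k *\<^sub>R sgn (\<psi> t)"
      unfolding p(1) by (simp add: sgn_scaleR power_sgn)
    finally show ?case .
  qed
  have sgn\<psi>: "((\<lambda>t. sgn (\<psi> t)) \<longlongrightarrow> sgn c) (at s)"
    using \<psi> c0 by (rule tendsto_sgn)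
  have right: "(u \<longlongrightarrow> sgn c) (at_right s)"
  proof (rule Lim_transform_eventually)
    show "((\<lambda>t. sgn (\<psi> t)) \<longlongrightarrow> sgn c) (at_right s)"
      using sgn\<psi> by (simp add: filterlim_at_split)
    have "\<forall>\<^sub>F t in at_right s. u t = sgn (t - s) ^ k *\<^sub>R sgn (\<psi> t)"
      using near by (simp add: eventually_at_split)
    moreover have "\<forall>\<^sub>F t in at_right s. s < t"
      by (simp add: eventually_at_filter)
    ultimately show "\<forall>\<^sub>F t in at_right s. sgn (\<psi> t) = u t"
      by eventually_elim simp
  qed
  have left: "(u \<longlongrightarrow> (- 1) ^ k *\<^sub>R sgn c) (at_left s)"
  proof (rule Lim_transform_eventually)
    show "((\<lambda>t. (- 1) ^ k *\<^sub>R sgn (\<psi> t)) \<longlongrightarrow> (- 1) ^ k *\<^sub>R sgn c) (at_left s)"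
      using sgn\<psi> by (intro tendsto_scaleR tendsto_const) (simp add: filterlim_at_split)
    have "\<forall>\<^sub>F t in at_left s. u t = sgn (t - s) ^ k *\<^sub>R sgn (\<psi> t)"
      using near by (simp add: eventually_at_split)
    moreover have "\<forall>\<^sub>F t in at_left s. t < s"
      by (simp add: eventually_at_filter)
    ultimately show "\<forall>\<^sub>F t in at_left s. (- 1) ^ k *\<^sub>R sgn (\<psi> t) = u t"
      by eventually_elim simp
  qed
  have "odd k"
  proof
    assume "even k"
    then have "(u \<longlongrightarrow> sgn c) (at_left s)"
      using left by simp
    moreover have "(u \<longlongrightarrow> u s) (at_left s)"
      using u s0 by (simp add: PC_def)
    ultimately have "u s = sgn c"
      by (metis tendsto_unique trivial_limit_at_left_real)
    then have "isCont u s"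
      using right \<open>(u \<longlongrightarrow> sgn c) (at_left s)\<close> by (simp add: isCont_def filterlim_at_split)
    then show False
      using s0 by simp
  qed
  then have "?p s $ j = 0" for j
    using below[where i = 0 and j = j] by (cases k) (auto simp: pF)
  then show "?p s = 0"
    by (simp add: vec_eq_iff)
  show "\<exists>l r. (u \<longlongrightarrow> l) (at_left s) \<and> (u \<longlongrightarrow> r) (at_right s) \<and> l + r = 0"
    using left right \<open>odd k\<close> by (intro exI conjI) auto
qed

text \<open>
  Some component of \<open>p\<close>, belonging to the column \<open>b\<close> of \<open>B\<close> say, does not vanish identically on the
  interval: otherwise all derivatives of all components would vanish at the midpoint. The zeros of \<open>p\<close> are
  zeros of that component, which satisfies a linear differential equation whose order is at most the
  dimension of the Krylov space of \<open>b\<close>.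
\<close>

lemma switching_function_zeros:
  fixes A :: "real^'n^'n" and B :: "real^'m^'n"
  assumes ctrl: "\<exists>w\<in>controllable_space A B. \<eta> \<bullet> w \<noteq> 0"
    and "a < b" and len: "ereal (b - a) \<le> d_const A"
    and Z: "finite Z" "Z \<subseteq> {a<..<b}" "\<And>z. z \<in> Z \<Longrightarrow> switching_function A B \<eta> z = 0"
  shows "card Z < q_const A B"
proof -
  define F where "F v t = \<eta> \<bullet> (mexp A (- t) *v v)" for v t
  interpret observed_flow "(*v) A" F
    unfolding F_def by (rule observed_flow_mexp)
  define s where "s = (a + b) / 2"
  have s: "s \<in> {a<..<b}"
    using \<open>a < b\<close> by (auto simp: s_def)
  obtain k j where kj: "F ((((*v) A) ^^ k) (column j B)) s \<noteq> 0"
    using observable_at_every_time[OF ctrl, of s] unfolding F_def by metis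
  obtain p where p: "p \<noteq> 0" "poly_act ((*v) A) p (column j B) = 0"
      "degree p \<le> dim (krylov A (column j B))"
      "\<And>c \<omega>. 0 < \<omega> \<Longrightarrow> quad_poly c \<omega> dvd p \<Longrightarrow> d_const A \<le> ereal (pi / \<omega>)"
    by (rule krylov_annihilator) blast
  have "card Z < degree p"
  proof (rule ccontr)
    assume "\<not> card Z < degree p"
    then obtain Y where Y: "Y \<subseteq> Z" "card Y = degree p" "finite Y"
      using obtain_subset_with_card_n[of "degree p" Z] by (auto simp: not_less)
    have vanish: "F (column j B) t = 0" if "t \<in> {a<..<b}" for t
    proof (rule zero_bound[OF p(1,2) _ Y(3) _ Y(2) _ that])
      show "\<omega> * (b - a) \<le> pi" if \<omega>: "0 < \<omega>" "quad_poly c \<omega> dvd p" for c \<omega>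
      proof -
        have "ereal (b - a) \<le> ereal (pi / \<omega>)"
          using len p(4)[OF \<omega>] by (rule order_trans)
        then show ?thesis
          using \<omega>(1) by (simp add: field_simps)
      qed
      show "Y \<subseteq> {a<..<b}"
        using Y Z by blast
      fix z assume "z \<in> Y"
      then show "F (column j B) z = 0"
        using Y(1) Z(3)[of z] by (auto simp: F_def simp flip: switching_function_nth)
    qed
    have "F ((((*v) A) ^^ i) (column j B)) t = 0" if "t \<in> {a<..<b}" for i t
      using that
    proof (induction i arbitrary: t)
      case 0
      then show ?case using vanish by simp
    next
      case (Suc i)
      let ?v = "(((*v) A) ^^ i) (column j B)"
      have "\<forall>\<^sub>F x in nhds t. F ?v x = 0"
        using eventually_nhds_in_open[of "{a<..<b}" t] Suc by (auto elim: eventually_mono)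
      then have "(F ?v has_real_derivative 0) (at t)"
        by (subst DERIV_cong_ev[OF refl _ refl]) auto
      then show ?case
        using DERIV_unique[OF deriv_F] by fastforce
    qed
    then show False
      using kj s by blast
  qed
  also have "degree p \<le> q_const A B"
    unfolding q_const_def by (rule order_trans[OF p(3)]) (auto intro!: Max_ge)
  finally show ?thesis .
qed

text \<open>
  The optimal time is positive whenever there are switching points or subintervals to speak of; in the
  remaining case both assertions are empty.
\<close>

theorem theorem1p3:
  fixes A :: "real^'n^'n" and B :: "real^'m^'n" and x0 :: "real^'n"
    and u :: "real \<Rightarrow> real^'m"
  assumes "B \<noteq> 0" and "x0 \<noteq> 0"
    and "\<exists>v. admissible_control A B x0 v"
    and "optimal_control A B x0 u"
  shows "(\<forall>a b. a < b \<longrightarrow> {a<..<b} \<subseteq> {0<..<optimal_time A B x0} \<longrightarrow> ereal (b - a) \<le> d_const A \<longrightarrow>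
            finite (switching_points (optimal_time A B x0) u \<inter> {a<..<b}) \<and>
            int (card (switching_points (optimal_time A B x0) u \<inter> {a<..<b})) \<le> int (q_const A B) - 1)
       \<and> (\<forall>s \<in> switching_points (optimal_time A B x0) u.
            \<exists>l r. (u \<longlongrightarrow> l) (at_left s) \<and> (u \<longlongrightarrow> r) (at_right s) \<and> l + r = 0)"
proof (cases "0 < optimal_time A B x0")
  case True
  define T where "T = optimal_time A B x0"
  obtain \<eta> where \<eta>: "\<exists>w\<in>controllable_space A B. \<eta> \<bullet> w \<noteq> 0"
    "\<And>s. s \<in> {0<..<T} \<Longrightarrow> switching_function A B \<eta> s \<noteq> 0 \<Longrightarrow>
      u s = sgn (switching_function A B \<eta> s)"
    unfolding T_def by (rule maximum_principle[OF assms(4) True]) blast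
  have u: "u \<in> PC (cball 0 1)"
    using assms(4) by (simp add: optimal_control_def)
  note switch = switching_structure[OF u \<eta>]
  have fin: "finite (switching_points T u \<inter> {a<..<b})" for a b
    by (rule finite_subset[of _ "{t. 0 < t \<and> \<not> isCont u t}"])
      (use u in \<open>auto simp: PC_def switching_points_def\<close>)
  have "card (switching_points T u \<inter> {a<..<b}) < q_const A B"
    if "a < b" "ereal (b - a) \<le> d_const A" for a b
    using switch(1) by (intro switching_function_zeros[OF \<eta>(1) that fin]) auto
  then have "int (card (switching_points T u \<inter> {a<..<b})) \<le> int (q_const A B) - 1"
    if "a < b" "ereal (b - a) \<le> d_const A" for a b
    using that by force
  then show ?thesis
    using fin switch(2) unfolding T_def[symmetric] by blast
next
  case False
  have "\<not> {a<..<b} \<subseteq> {0<..<optimal_time A B x0}" if "a < b" for a b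
    using False dense[OF that] by fastforce
  moreover have "switching_points (optimal_time A B x0) u = {}"
    using False by (auto simp: switching_points_def)
  ultimately show ?thesis
    by blast
qed

end
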